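(* For any sparsity pattern $\mathcal{E}$ (the edge set of an undirected graph on $\{1,\ldots,n\}$), $$\mathit{DSOS}_{n,2d}(\mathcal{E})\subset \mathit{SDSOS}_{n,2d}(\mathcal{E})\subset \mathit{SSOS}_{n,2d}(\mathcal{E})\subseteq \mathit{SOS}_{n,2d}(\mathcal{E}),$$ and the first two inclusions are strict. The third inclusion is strict unless $\mathcal{E}$ is full or $d=1$, in which cases $\mathit{SSOS}_{n,2d}(\mathcal{E})=\mathit{SOS}_{n,2d}(\mathcal{E})$.
   Context: Sparsity patterns. $\mathcal{G}(\mathcal{V},\mathcal{E})$ is an undirected graph with $\mathcal{V}=\{1,\ldots,n\}$ and $\mathcal{E}\subseteq\mathcal{V}\times\mathcal{V}$ such that $(i,j)\in\mathcal{E}$ implies $(j,i)\in\mathcal{E}$; put $\mathcal{E}^*=\mathcal{E}\cup\{(i,i): i\in\mathcal{V}\}$. $\mathcal{E}$ is full if it contains all pairs $(i,j)$ with $i\neq j$. $\mathbb{S}^n(\mathcal{E},0)$ is the set of symmetric $n\times n$ real matrices $X$ with $X_{ij}=X_{ji}=0$ whenever $(i,j)\notin\mathcal{E}^*$. Polynomials. $\mathbb{R}[x]_{n,2d}$ is the set of real polynomials in $x=(x_1,\ldots,x_n)$ of degree at most $2d$. For $\alpha\in\mathbb{N}^n$, $x^\alpha=\prod_i x_i^{\alpha_i}$, $|\alpha|=\sum_i\alpha_i$, and $\mathbb{N}^n_d=\{\alpha\in\mathbb{N}^n:|\alpha|\le d\}$. $v_d(x)$ is the vector of all monomials $x^\alpha$,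 $\alpha\in\mathbb{N}^n_d$. A Gram matrix of $p$ is a symmetric matrix $Q$ of size $\binom{n+d}{d}$, indexed by $\beta,\gamma\in\mathbb{N}^n_d$, with $p(x)=v_d(x)^{\mathsf T}Q\,v_d(x)$. Correlative sparsity. For $p=\sum_{|\alpha|\le 2d}c_\alpha x^\alpha$, $\mathrm{csp}(p)$ is the symmetric $n\times n$ matrix whose $(i,j)$ entry is $1$ if $i=j$ or if there is $\alpha$ with $\alpha_i,\alpha_j\ge1$ and $c_\alpha\ne0$, and $0$ otherwise. $\mathbb{R}[x]_{n,2d}(\mathcal{E})=\{p\in\mathbb{R}[x]_{n,2d}:\mathrm{csp}(p)\in\mathbb{S}^n(\mathcal{E},0)\}$. Diagonal dominance. A symmetric $r\times r$ matrix $A$ is diagonally dominant (DD) if $A_{ii}\ge\sum_{j\neq i}|A_{ij}|$ for all $i$; it is scaled diagonally dominant (SDD) if there is a positive definite diagonal $r\times r$ matrix $D$ such that $DAD$ is DD. Cones. $\mathit{SOS}_{n,2d}$ is the set of $p\in\mathbb{R}[x]_{n,2d}$ that are finite sums of squares of polynomials of degree at most $d$ (equivalently, that have a positive semidefinite Gram matrix). $\mathit{DSOS}_{n,2d}$ (resp. $\mathit{SDSOS}_{n,2d}$) is the set of $p\in\mathbb{R}[x]_{n,2d}$ that have a DD (resp. SDD) Gram matrix. Then $\mathit{SOS}_{n,2d}(\mathcal{E})=\mathit{SOS}_{n,2d}\cap\mathbb{R}[x]_{n,2d}(\mathcal{E})$, $\mathit{DSOS}_{n,2d}(\mathcal{E})=\mathit{DSOS}_{n,2d}\cap\mathbb{R}[x]_{n,2d}(\mathcal{E})$,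 and $\mathit{SDSOS}_{n,2d}(\mathcal{E})=\mathit{SDSOS}_{n,2d}\cap\mathbb{R}[x]_{n,2d}(\mathcal{E})$. Finally, $\mathit{SSOS}_{n,2d}(\mathcal{E})$ is the set of $p\in\mathbb{R}[x]_{n,2d}$ that have a positive semidefinite Gram matrix $Q$ with $Q_{\beta,\gamma}=0$ whenever there exist $i\neq j$ with $(i,j)\notin\mathcal{E}$, $\beta_i+\gamma_i\neq0$ and $\beta_j+\gamma_j\neq0$.
   Formalization: Takes n,d ≥ 1. Strictness of the second inclusion is claimed except when d=1 and E has no edge between distinct vertices; strictness of the third also requires that the graph is not a disjoint union of cliques. In the excluded cases the sets coincide. *)

theory Defs
  imports Complex_Main "HOL-Library.Poly_Mapping" "HOL-Library.FuncSet"
begin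

text \<open>
  A real polynomial is a finitely supported map from exponent vectors to coefficients, and an
  exponent vector is a finitely supported map from variable indices to exponents; multiplication
  of poly mappings is the convolution product, i.e. multiplication of polynomials.  The variables
  are indexed by \<open>{1..n}\<close>.
\<close>

type_synonym expnt = "nat \<Rightarrow>\<^sub>0 nat"
type_synonym rpoly = "expnt \<Rightarrow>\<^sub>0 real"

definition expnts :: "nat \<Rightarrow> nat \<Rightarrow> expnt set" where
  "expnts n d = {\<alpha>. Poly_Mapping.keys \<alpha> \<subseteq> {1..n} \<and> (\<Sum>i\<in>{1..n}. Poly_Mapping.lookup \<alpha> i) \<le> d}"

text \<open>Sums over \<open>expnts n d\<close> below are therefore genuine finite sums.\<close>

lemma finite_expnts: "finite (expnts n d)"
proof -
  have "inj_on (\<lambda>\<alpha>. restrict (Poly_Mapping.lookup \<alpha>) {1..n}) (expnts n d)"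
  proof (rule inj_onI)
    fix \<alpha> \<beta> :: expnt
    assume a: "\<alpha> \<in> expnts n d" and b: "\<beta> \<in> expnts n d"
      and e: "restrict (Poly_Mapping.lookup \<alpha>) {1..n} = restrict (Poly_Mapping.lookup \<beta>) {1..n}"
    have "Poly_Mapping.lookup \<alpha> i = Poly_Mapping.lookup \<beta> i" for i
    proof (cases "i \<in> {1..n}")
      case True
      then show ?thesis using fun_cong[OF e, of i] by simp
    next
      case False
      then have "i \<notin> Poly_Mapping.keys \<alpha>" "i \<notin> Poly_Mapping.keys \<beta>"
        using a b by (auto simp: expnts_def)
      then show ?thesis by (simp add: in_keys_iff)
    qed
    then show "\<alpha> = \<beta>" by (intro poly_mapping_eqI)
  qed
  moreover have "(\<lambda>\<alpha>. restrict (Poly_Mapping.lookup \<alpha>) {1..n}) ` expnts n d \<subseteq> {1..n} \<rightarrow>\<^sub>E {0..d}"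
  proof
    fix f assume "f \<in> (\<lambda>\<alpha>. restrict (Poly_Mapping.lookup \<alpha>) {1..n}) ` expnts n d"
    then obtain \<alpha> where f: "f = restrict (Poly_Mapping.lookup \<alpha>) {1..n}" and a: "\<alpha> \<in> expnts n d" by auto
    have "Poly_Mapping.lookup \<alpha> i \<le> d" if "i \<in> {1..n}" for i
      using member_le_sum[of i "{1..n}" "Poly_Mapping.lookup \<alpha>"] a that
      by (fastforce simp: expnts_def)
    then show "f \<in> {1..n} \<rightarrow>\<^sub>E {0..d}" by (auto simp: f)
  qed
  moreover have "finite ({1..n} \<rightarrow>\<^sub>E {0..d})" by (intro finite_PiE) auto
  ultimately show ?thesis by (meson finite_imageD finite_subset)
qed

definition monomial :: "expnt \<Rightarrow> rpoly" where
  "monomial \<alpha> = Poly_Mapping.single \<alpha> 1"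

definition const_poly :: "real \<Rightarrow> rpoly" where
  "const_poly c = Poly_Mapping.single 0 c"

definition polys :: "nat \<Rightarrow> nat \<Rightarrow> rpoly set" where
  "polys n m = {p. Poly_Mapping.keys p \<subseteq> expnts n m}"


text \<open>
  A matrix whose rows and columns are indexed by a finite set \<open>I\<close> is a binary function, of which
  only the values on \<open>I\<close> matter.
\<close>

type_synonym 'a rmat = "'a \<Rightarrow> 'a \<Rightarrow> real"

definition symmetric_on :: "'a set \<Rightarrow> 'a rmat \<Rightarrow> bool" where
  "symmetric_on I A \<longleftrightarrow> (\<forall>i\<in>I. \<forall>j\<in>I. A i j = A j i)"

definition diagonal_on :: "'a set \<Rightarrow> 'a rmat \<Rightarrow> bool" where
  "diagonal_on I A \<longleftrightarrow> (\<forall>i\<in>I. \<forall>j\<in>I. i \<noteq> j \<longrightarrow> A i j = 0)"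

definition mat_prod :: "'a set \<Rightarrow> 'a rmat \<Rightarrow> 'a rmat \<Rightarrow> 'a rmat" where
  "mat_prod I A B = (\<lambda>i k. \<Sum>j\<in>I. A i j * B j k)"

definition quad_form :: "'a set \<Rightarrow> 'a rmat \<Rightarrow> ('a \<Rightarrow> real) \<Rightarrow> real" where
  "quad_form I A u = (\<Sum>i\<in>I. \<Sum>j\<in>I. u i * A i j * u j)"

definition pos_semidef :: "'a set \<Rightarrow> 'a rmat \<Rightarrow> bool" where
  "pos_semidef I A \<longleftrightarrow> symmetric_on I A \<and> (\<forall>u. 0 \<le> quad_form I A u)"

definition pos_def :: "'a set \<Rightarrow> 'a rmat \<Rightarrow> bool" where
  "pos_def I A \<longleftrightarrow> symmetric_on I A \<and> (\<forall>u. (\<exists>i\<in>I. u i \<noteq> 0) \<longrightarrow> 0 < quad_form I A u)"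

definition diag_dominant :: "'a set \<Rightarrow> 'a rmat \<Rightarrow> bool" where
  "diag_dominant I A \<longleftrightarrow>
     symmetric_on I A \<and> (\<forall>i\<in>I. (\<Sum>j\<in>I - {i}. \<bar>A i j\<bar>) \<le> A i i)"

definition scaled_diag_dominant :: "'a set \<Rightarrow> 'a rmat \<Rightarrow> bool" where
  "scaled_diag_dominant I A \<longleftrightarrow>
     symmetric_on I A \<and>
     (\<exists>D. diagonal_on I D \<and> pos_def I D \<and> diag_dominant I (mat_prod I (mat_prod I D A) D))"


definition gram_matrix :: "nat \<Rightarrow> nat \<Rightarrow> rpoly \<Rightarrow> expnt rmat \<Rightarrow> bool" where
  "gram_matrix n d p Q \<longleftrightarrow>
     symmetric_on (expnts n d) Q \<and>
     p = (\<Sum>\<beta>\<in>expnts n d. \<Sum>\<gamma>\<in>expnts n d. monomial \<beta> * const_poly (Q \<beta> \<gamma>) * monomial \<gamma>)"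


definition sparsity_pattern :: "nat \<Rightarrow> (nat \<times> nat) set \<Rightarrow> bool" where
  "sparsity_pattern n E \<longleftrightarrow> E \<subseteq> {1..n} \<times> {1..n} \<and> sym E"

definition with_loops :: "nat \<Rightarrow> (nat \<times> nat) set \<Rightarrow> (nat \<times> nat) set" where
  "with_loops n E = E \<union> {(i, i) | i. i \<in> {1..n}}"

definition full_pattern :: "nat \<Rightarrow> (nat \<times> nat) set \<Rightarrow> bool" where
  "full_pattern n E \<longleftrightarrow> (\<forall>i\<in>{1..n}. \<forall>j\<in>{1..n}. i \<noteq> j \<longrightarrow> (i, j) \<in> E)"

text \<open>
  The graph is a vertex-disjoint union of complete graphs (isolated vertices included) iff
  adjacent-or-equal is a transitive relation on the vertices.
\<close>

definition disjoint_cliques :: "nat \<Rightarrow> (nat \<times> nat) set \<Rightarrow> bool" where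
  "disjoint_cliques n E \<longleftrightarrow> trans (with_loops n E)"

definition sparse_sym_mats :: "nat \<Rightarrow> (nat \<times> nat) set \<Rightarrow> nat rmat set" where
  "sparse_sym_mats n E =
     {X. symmetric_on {1..n} X \<and>
         (\<forall>i\<in>{1..n}. \<forall>j\<in>{1..n}. (i, j) \<notin> with_loops n E \<longrightarrow> X i j = 0 \<and> X j i = 0)}"

definition csp :: "rpoly \<Rightarrow> nat rmat" where
  "csp p = (\<lambda>i j. if i = j \<or> (\<exists>\<alpha>. 1 \<le> Poly_Mapping.lookup \<alpha> i \<and> 1 \<le> Poly_Mapping.lookup \<alpha> j \<and> Poly_Mapping.lookup p \<alpha> \<noteq> 0)
                  then 1 else 0)"

definition sparse_polys :: "nat \<Rightarrow> nat \<Rightarrow> (nat \<times> nat) set \<Rightarrow> rpoly set" where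
  "sparse_polys n m E = {p \<in> polys n m. csp p \<in> sparse_sym_mats n E}"


definition SOS :: "nat \<Rightarrow> nat \<Rightarrow> rpoly set" where
  "SOS n d = {p \<in> polys n (2 * d). \<exists>qs. set qs \<subseteq> polys n d \<and> p = (\<Sum>q\<leftarrow>qs. q ^ 2)}"

definition DSOS :: "nat \<Rightarrow> nat \<Rightarrow> rpoly set" where
  "DSOS n d = {p \<in> polys n (2 * d). \<exists>Q. gram_matrix n d p Q \<and> diag_dominant (expnts n d) Q}"

definition SDSOS :: "nat \<Rightarrow> nat \<Rightarrow> rpoly set" where
  "SDSOS n d =
     {p \<in> polys n (2 * d). \<exists>Q. gram_matrix n d p Q \<and> scaled_diag_dominant (expnts n d) Q}"

definition SOS_sparse :: "nat \<Rightarrow> nat \<Rightarrow> (nat \<times> nat) set \<Rightarrow> rpoly set" where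
  "SOS_sparse n d E = SOS n d \<inter> sparse_polys n (2 * d) E"

definition DSOS_sparse :: "nat \<Rightarrow> nat \<Rightarrow> (nat \<times> nat) set \<Rightarrow> rpoly set" where
  "DSOS_sparse n d E = DSOS n d \<inter> sparse_polys n (2 * d) E"

definition SDSOS_sparse :: "nat \<Rightarrow> nat \<Rightarrow> (nat \<times> nat) set \<Rightarrow> rpoly set" where
  "SDSOS_sparse n d E = SDSOS n d \<inter> sparse_polys n (2 * d) E"

definition SSOS :: "nat \<Rightarrow> nat \<Rightarrow> (nat \<times> nat) set \<Rightarrow> rpoly set" where
  "SSOS n d E =
     {p \<in> polys n (2 * d).
        \<exists>Q. gram_matrix n d p Q \<and> pos_semidef (expnts n d) Q \<and>
            (\<forall>\<beta>\<in>expnts n d. \<forall>\<gamma>\<in>expnts n d.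
               (\<exists>i\<in>{1..n}. \<exists>j\<in>{1..n}. i \<noteq> j \<and> (i, j) \<notin> E \<and>
                  Poly_Mapping.lookup \<beta> i + Poly_Mapping.lookup \<gamma> i \<noteq> 0 \<and> Poly_Mapping.lookup \<beta> j + Poly_Mapping.lookup \<gamma> j \<noteq> 0)
               \<longrightarrow> Q \<beta> \<gamma> = 0)}"

end

theory Submission
  imports Defs "HOL-Computational_Algebra.Polynomial"
begin

text \<open>
  Multiplying a scaled diagonally dominant matrix entrywise by a symmetric \<open>M\<close> with
  \<open>\<bar>M i j\<bar> \<le> M i i\<close> keeps it scaled diagonally dominant.  Taking for \<open>M\<close> the indicator of the
  allowed entries turns any such Gram matrix of a sparse polynomial into a sparse one, and taking
  for \<open>M\<close> a sign pattern \<open>\<phi> (\<beta> + \<gamma>)\<close> with \<open>\<phi> (\<beta> + \<beta>) = 1\<close> gives linear functionals that are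
  nonnegative on \<open>SDSOS\<close> but not on all squares.  If \<open>i - j - k\<close> is a path without the edge
  \<open>i - k\<close>, then \<open>(1 + x\<^sub>i + x\<^sub>j x\<^sub>k)\<^sup>2 + (x\<^sub>i x\<^sub>j - x\<^sub>k)\<^sup>2\<close> has no term with both \<open>x\<^sub>i\<close> and \<open>x\<^sub>k\<close>; a
  sparse Gram matrix would amount to a polynomial in \<open>x\<^sub>j\<close> equal to \<open>1 / (1 + x\<^sub>j\<^sup>2)\<close>.
\<close>

section \<open>Matrices indexed by a finite set\<close>

definition bilin :: "'a set \<Rightarrow> 'a rmat \<Rightarrow> ('a \<Rightarrow> real) \<Rightarrow> ('a \<Rightarrow> real) \<Rightarrow> real" where
  "bilin I A u v = (\<Sum>i\<in>I. \<Sum>j\<in>I. u i * A i j * v j)"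

lemma quad_form_bilin: "quad_form I A u = bilin I A u u"
  by (simp add: quad_form_def bilin_def)

lemma bilin_add_left: "bilin I A (\<lambda>i. u i + v i) w = bilin I A u w + bilin I A v w"
  by (simp add: bilin_def algebra_simps sum.distrib)

lemma bilin_add_right: "bilin I A w (\<lambda>i. u i + v i) = bilin I A w u + bilin I A w v"
  by (simp add: bilin_def algebra_simps sum.distrib)

lemma bilin_scale_left: "bilin I A (\<lambda>i. c * u i) v = c * bilin I A u v"
  by (simp add: bilin_def sum_distrib_left mult.assoc)

lemma bilin_scale_right: "bilin I A u (\<lambda>i. c * v i) = c * bilin I A u v"
  by (simp add: bilin_def sum_distrib_left mult_ac)

lemma bilin_commute:
  assumes "symmetric_on I A"
  shows "bilin I A u v = bilin I A v u"
proof -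
  have "bilin I A u v = (\<Sum>i\<in>I. \<Sum>j\<in>I. v j * A j i * u i)"
    unfolding bilin_def using assms by (intro sum.cong refl) (auto simp: symmetric_on_def)
  also have "\<dots> = bilin I A v u"
    unfolding bilin_def by (rule sum.swap)
  finally show ?thesis .
qed

text \<open>The form at \<open>u + t * v\<close> is a quadratic in \<open>t\<close> without negative
  values; its minimum over \<open>t\<close> gives the inequality.\<close>

lemma bilin_Cauchy_Schwarz:
  assumes "pos_semidef I A"
  shows "(bilin I A u v)\<^sup>2 \<le> bilin I A u u * bilin I A v v"
proof -
  have sym: "symmetric_on I A" and nonneg: "0 \<le> bilin I A w w" for w
    using assms by (auto simp: pos_semidef_def quad_form_bilin)
  have expand: "0 \<le> bilin I A u u + 2 * t * bilin I A u v + t\<^sup>2 * bilin I A v v" for t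
    using nonneg[of "\<lambda>i. u i + t * v i"] bilin_commute[OF sym, of v u]
    by (simp add: bilin_add_left bilin_add_right bilin_scale_left bilin_scale_right
        algebra_simps power2_eq_square)
  show ?thesis
  proof (cases "bilin I A v v = 0")
    case True
    have "bilin I A u v = 0"
    proof (rule ccontr)
      assume "bilin I A u v \<noteq> 0"
      \<comment> \<open>For isotropic \<open>v\<close> the quadratic is affine in \<open>t\<close>,
        and its value at this \<open>t\<close> is \<open>-1\<close>.\<close>
      then show False
        using expand[of "- (bilin I A u u + 1) / (2 * bilin I A u v)"] True by (simp add: field_simps)
    qed
    then show ?thesis using True by simp
  next
    case False
    then have pos: "0 < bilin I A v v" using nonneg[of v] by simp
    \<comment> \<open>The value of the quadratic at its minimiser.\<close>
    have "0 \<le> bilin I A u u - (bilin I A u v)\<^sup>2 / bilin I A v v"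
      using expand[of "- bilin I A u v / bilin I A v v"] pos
      by (simp add: power2_eq_square field_simps)
    then show ?thesis using pos by (simp add: field_simps)
  qed
qed

text \<open>This puts the monomial vector of a zero of a polynomial into the kernel of each of its
  positive semidefinite Gram matrices.\<close>

lemma bilin_eq_0_if_isotropic:
  assumes "pos_semidef I A" "quad_form I A v = 0"
  shows "bilin I A u v = 0"
  using bilin_Cauchy_Schwarz[OF assms(1), of u v] assms(2) by (simp add: quad_form_bilin)

lemma bilin_unit_left:
  assumes "finite I" "k \<in> I"
  shows "bilin I A (\<lambda>i. if i = k then 1 else 0) v = (\<Sum>j\<in>I. A k j * v j)"
proof -
  have "bilin I A (\<lambda>i. if i = k then 1 else 0) v
      = (\<Sum>i\<in>I. if i = k then (\<Sum>j\<in>I. A k j * v j) else 0)"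
    unfolding bilin_def by (intro sum.cong refl) auto
  then show ?thesis using assms by simp
qed

lemma quad_form_unit:
  assumes "finite I" "k \<in> I"
  shows "quad_form I A (\<lambda>i. if i = k then 1 else 0) = A k k"
  using assms by (simp add: quad_form_bilin bilin_unit_left if_distrib[of "\<lambda>x. _ * x"] cong: if_cong)

text \<open>Cauchy-Schwarz against a unit vector. Divided by \<open>A k k\<close>, it says that the
  Schur complement at \<open>k\<close> is positive semidefinite.\<close>

lemma pos_semidef_row_bound:
  assumes "pos_semidef I A" "finite I" "k \<in> I"
  shows "(\<Sum>j\<in>I. A k j * v j)\<^sup>2 \<le> A k k * quad_form I A v"
  using bilin_Cauchy_Schwarz[OF assms(1), of "\<lambda>i. if i = k then 1 else 0" v]
  unfolding quad_form_bilin[symmetric]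
  unfolding quad_form_unit[OF assms(2,3)] bilin_unit_left[OF assms(2,3)] .

text \<open>
  Schur complements, one index at a time.  If \<open>A k k = 0\<close> then row \<open>k\<close> vanishes and
  \<open>w = 0\<close> below, by the convention \<open>x / 0 = 0\<close>, so this case needs no separate treatment.
\<close>

lemma pos_semidef_imp_sum_rank_one:
  assumes "finite I" "pos_semidef I A"
  shows "\<exists>vs. \<forall>i\<in>I. \<forall>j\<in>I. A i j = (\<Sum>v\<leftarrow>vs. v i * v j)"
  using assms
proof (induction I arbitrary: A rule: finite_induct)
  case empty
  then show ?case by simp
next
  case (insert k J)
  let ?I = "insert k J"
  have fin: "finite ?I" using insert.hyps by simp
  have sym: "symmetric_on ?I A" using insert.prems by (simp add: pos_semidef_def)
  have nonneg: "0 \<le> A k k"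
    using insert.prems quad_form_unit[OF fin, of k A] by (metis insertI1 pos_semidef_def)
  have row: "A k j = 0" if "A k k = 0" "j \<in> ?I" for j
  proof -
    have "(\<Sum>m\<in>?I. A k m * (if m = j then 1 else 0))\<^sup>2 \<le> 0"
      using pos_semidef_row_bound[OF insert.prems fin, of k "\<lambda>m. if m = j then 1 else 0"] that(1) by simp
    moreover have "(\<Sum>m\<in>?I. A k m * (if m = j then 1 else 0)) = A k j"
      using fin that(2) by (simp add: if_distrib[of "\<lambda>x. _ * x"] cong: if_cong)
    ultimately show ?thesis by simp
  qed
  define w where "w i = A k i / sqrt (A k k)" for i
  have ww: "w i * w j = A k i * A k j / A k k" for i j
    using nonneg by (simp add: w_def)
  define B where "B i j = A i j - w i * w j" for i j
  have "pos_semidef J B"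
    unfolding pos_semidef_def
  proof (intro conjI allI)
    show "symmetric_on J B"
      using sym by (auto simp: symmetric_on_def B_def)
    fix u :: "'a \<Rightarrow> real"
    define u' where "u' i = (if i = k then 0 else u i)" for i
    have u': "u' i = u i" if "i \<in> J" for i using that insert.hyps by (auto simp: u'_def)
    have q: "quad_form ?I A u' = quad_form J A u"
      using insert.hyps u' by (simp add: quad_form_def u'_def[of k] cong: sum.cong)
    have "(\<Sum>j\<in>J. A k j * u j)\<^sup>2 \<le> A k k * quad_form J A u"
      using pos_semidef_row_bound[OF insert.prems fin, of k u'] insert.hyps u' q
      by (simp add: u'_def[of k] cong: sum.cong)
    moreover have "0 \<le> quad_form J A u"
      using insert.prems q unfolding pos_semidef_def by metis
    ultimately have "(\<Sum>j\<in>J. A k j * u j)\<^sup>2 / A k k \<le> quad_form J A u"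
      using nonneg by (cases "A k k = 0") (auto simp: field_simps)
    moreover have "quad_form J B u = quad_form J A u - (\<Sum>i\<in>J. w i * u i)\<^sup>2"
      by (simp add: quad_form_def B_def algebra_simps sum_subtractf power2_eq_square sum_product)
    moreover have "(\<Sum>i\<in>J. w i * u i)\<^sup>2 = (\<Sum>j\<in>J. A k j * u j)\<^sup>2 / A k k"
      using nonneg by (simp add: w_def sum_divide_distrib[symmetric] power_divide)
    ultimately show "0 \<le> quad_form J B u" by simp
  qed
  then obtain vs where vs: "\<forall>i\<in>J. \<forall>j\<in>J. B i j = (\<Sum>v\<leftarrow>vs. v i * v j)"
    using insert.IH by blast
  \<comment> \<open>\<open>w\<close> alone produces row and column \<open>k\<close>; the vectors for
    the complement \<open>B\<close> are padded with \<open>0\<close> at \<open>k\<close>.\<close>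
  define vs' where "vs' = w # map (\<lambda>v i. if i = k then 0 else v i) vs"
  have "A i j = (\<Sum>v\<leftarrow>vs'. v i * v j)" if "i \<in> ?I" "j \<in> ?I" for i j
  proof (cases "i = k \<or> j = k")
    case True
    have "A k m = w k * w m" if "m \<in> ?I" for m
      using row[OF _ that] by (cases "A k k = 0") (simp_all add: ww)
    moreover have "A i j = A j i" using sym that unfolding symmetric_on_def by blast
    ultimately have "A i j = w i * w j" using True that by (metis mult.commute)
    moreover have "(\<Sum>v\<leftarrow>vs. (if i = k then 0 else v i) * (if j = k then 0 else v j)) = 0"
      using True by (intro sum_list_0[THEN trans[rotated]] arg_cong[of _ _ sum_list] map_cong refl) auto
    ultimately show ?thesis by (simp add: vs'_def o_def)
  next
    case False
    with that have ij: "i \<in> J" "j \<in> J" by auto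
    with vs have "A i j = w i * w j + (\<Sum>v\<leftarrow>vs. v i * v j)"
      by (metis B_def add.commute diff_add_cancel)
    with False show ?thesis by (simp add: vs'_def o_def)
  qed
  then show ?case by blast
qed

text \<open>The quadratic form is a sum of squares of linear forms, one for each vector.\<close>

lemma sum_rank_one_imp_pos_semidef:
  "pos_semidef I (\<lambda>i j. \<Sum>v\<leftarrow>vs. v i * v j)"
proof -
  have "quad_form I (\<lambda>i j. \<Sum>v\<leftarrow>vs. v i * v j) u = (\<Sum>v\<leftarrow>vs. (\<Sum>i\<in>I. u i * v i)\<^sup>2)" for u
  proof (induction vs)
    case Nil
    then show ?case by (simp add: quad_form_def)
  next
    case (Cons v vs)
    then show ?case
      by (simp add: quad_form_def algebra_simps sum.distrib power2_eq_square sum_product)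
  qed
  then show ?thesis
    unfolding pos_semidef_def symmetric_on_def
    by (auto simp: mult.commute intro!: sum_list_nonneg)
qed

section \<open>Diagonal dominance and scaling\<close>

text \<open>By symmetry the sum is twice the sum of \<open>w i\<close> times the row sum of row
  \<open>i\<close>, and diagonal dominance makes row sums nonnegative.\<close>

lemma diag_dominant_weighted_sum_nonneg:
  assumes "finite I" "diag_dominant I A" "\<And>i. i \<in> I \<Longrightarrow> 0 \<le> w i"
  shows "0 \<le> (\<Sum>i\<in>I. \<Sum>j\<in>I. A i j * (w i + w j))"
proof -
  have sym: "symmetric_on I A" using assms(2) by (simp add: diag_dominant_def)
  have row: "0 \<le> (\<Sum>j\<in>I. A i j)" if "i \<in> I" for i
  proof -
    have "(\<Sum>j\<in>I. A i j) = A i i + (\<Sum>j\<in>I - {i}. A i j)"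
      using assms(1) that by (simp add: sum.remove)
    moreover have "- (\<Sum>j\<in>I - {i}. A i j) \<le> (\<Sum>j\<in>I - {i}. \<bar>A i j\<bar>)"
      using sum_abs[of "A i" "I - {i}"] by linarith
    ultimately show ?thesis using assms(2) that by (force simp: diag_dominant_def)
  qed
  have "(\<Sum>i\<in>I. \<Sum>j\<in>I. A i j * w j) = (\<Sum>i\<in>I. \<Sum>j\<in>I. A j i * w i)"
    by (rule sum.swap)
  also have "\<dots> = (\<Sum>i\<in>I. \<Sum>j\<in>I. A i j * w i)"
    using sym by (intro sum.cong refl) (auto simp: symmetric_on_def)
  finally have "(\<Sum>i\<in>I. \<Sum>j\<in>I. A i j * (w i + w j)) = 2 * (\<Sum>i\<in>I. \<Sum>j\<in>I. A i j * w i)"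
    by (simp add: distrib_left sum.distrib)
  also have "\<dots> = 2 * (\<Sum>i\<in>I. w i * (\<Sum>j\<in>I. A i j))"
    by (simp add: sum_distrib_left mult.commute)
  finally show ?thesis using row assms(3) by (auto intro!: sum_nonneg)
qed

text \<open>Giving all off-diagonal entries the worst sign yields a matrix \<open>C\<close> that is
  still dominant. Weights \<open>(u i)^2 / 2\<close> then bound the form from below, since
  \<open>2 * \<bar>u i * u j\<bar>\<close> is at most the sum of the two squares.\<close>

lemma diag_dominant_imp_pos_semidef:
  assumes "finite I" "diag_dominant I A"
  shows "pos_semidef I A"
  unfolding pos_semidef_def
proof (intro conjI allI)
  show sym: "symmetric_on I A" using assms by (simp add: diag_dominant_def)
  fix u :: "'a \<Rightarrow> real"
  define C where "C i j = (if i = j then A i i else - \<bar>A i j\<bar>)" for i j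
  have "diag_dominant I C"
    unfolding diag_dominant_def
  proof (intro conjI ballI)
    show "symmetric_on I C" using sym by (auto simp: symmetric_on_def C_def)
    fix i assume "i \<in> I"
    moreover have "(\<Sum>j\<in>I - {i}. \<bar>C i j\<bar>) = (\<Sum>j\<in>I - {i}. \<bar>A i j\<bar>)"
      by (intro sum.cong refl) (auto simp: C_def)
    ultimately show "(\<Sum>j\<in>I - {i}. \<bar>C i j\<bar>) \<le> C i i"
      using assms(2) by (simp add: diag_dominant_def C_def)
  qed
  then have "0 \<le> (\<Sum>i\<in>I. \<Sum>j\<in>I. C i j * ((u i)\<^sup>2 / 2 + (u j)\<^sup>2 / 2))"
    using assms(1) by (intro diag_dominant_weighted_sum_nonneg) auto
  also have "\<dots> \<le> quad_form I A u"
    unfolding quad_form_def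
  proof (intro sum_mono)
    fix i j
    show "C i j * ((u i)\<^sup>2 / 2 + (u j)\<^sup>2 / 2) \<le> u i * A i j * u j"
    proof (cases "i = j")
      case True
      then show ?thesis by (simp add: C_def power2_eq_square)
    next
      case False
      have "\<bar>u i * u j\<bar> \<le> (u i)\<^sup>2 / 2 + (u j)\<^sup>2 / 2"
        using sum_squares_bound[of "\<bar>u i\<bar>" "\<bar>u j\<bar>"] by (simp add: abs_mult)
      then have "\<bar>A i j\<bar> * \<bar>u i * u j\<bar> \<le> \<bar>A i j\<bar> * ((u i)\<^sup>2 / 2 + (u j)\<^sup>2 / 2)"
        by (intro mult_left_mono) auto
      moreover have "- (u i * A i j * u j) \<le> \<bar>A i j\<bar> * \<bar>u i * u j\<bar>"
        using abs_ge_minus_self[of "u i * A i j * u j"] by (simp add: abs_mult mult_ac)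
      ultimately show ?thesis using False by (simp add: C_def)
    qed
  qed
  finally show "0 \<le> quad_form I A u" .
qed

lemma mat_prod_diagonal:
  assumes "finite I" "diagonal_on I D" "i \<in> I" "k \<in> I"
  shows "mat_prod I (mat_prod I D A) D i k = D i i * A i k * D k k"
proof -
  have left: "mat_prod I D A i j = D i i * A i j" for j
  proof -
    have "mat_prod I D A i j = (\<Sum>m\<in>I. if m = i then D i i * A i j else 0)"
      unfolding mat_prod_def using assms by (intro sum.cong refl) (auto simp: diagonal_on_def)
    then show ?thesis using assms by simp
  qed
  have "mat_prod I (mat_prod I D A) D i k
      = (\<Sum>m\<in>I. if m = k then mat_prod I D A i k * D k k else 0)"
    unfolding mat_prod_def[of I "mat_prod I D A"]
    using assms by (intro sum.cong refl) (auto simp: diagonal_on_def)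
  then show ?thesis using assms by (simp add: left)
qed

text \<open>A positive definite diagonal \<open>D\<close> amounts to a positive vector
  \<open>c\<close>. In row \<open>i\<close> of \<open>D A D\<close> the left factor
  \<open>c i\<close> cancels, so only the scaling of columns remains.\<close>

lemma scaled_diag_dominant_iff:
  assumes "finite I"
  shows "scaled_diag_dominant I A \<longleftrightarrow> symmetric_on I A \<and>
    (\<exists>c. (\<forall>i\<in>I. 0 < c i) \<and> (\<forall>i\<in>I. (\<Sum>j\<in>I - {i}. \<bar>A i j\<bar> * c j) \<le> A i i * c i))"
    (is "_ \<longleftrightarrow> ?sym \<and> (\<exists>c. ?P c)")
proof -
  have scale: "diag_dominant I (mat_prod I (mat_prod I D A) D) \<longleftrightarrow>
      (\<forall>i\<in>I. (\<Sum>j\<in>I - {i}. \<bar>A i j\<bar> * c j) \<le> A i i * c i)"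
    if D: "diagonal_on I D" "\<And>i. i \<in> I \<Longrightarrow> D i i = c i" and c: "\<And>i. i \<in> I \<Longrightarrow> 0 < c i" and ?sym for D c
  proof -
    have prod: "mat_prod I (mat_prod I D A) D i k = c i * A i k * c k" if "i \<in> I" "k \<in> I" for i k
      using mat_prod_diagonal[OF assms D(1)] D(2) that by simp
    have "symmetric_on I (mat_prod I (mat_prod I D A) D)"
      using \<open>?sym\<close> by (auto simp: symmetric_on_def prod)
    moreover have "(\<Sum>j\<in>I - {i}. \<bar>mat_prod I (mat_prod I D A) D i j\<bar>)
        \<le> mat_prod I (mat_prod I D A) D i i
      \<longleftrightarrow> (\<Sum>j\<in>I - {i}. \<bar>A i j\<bar> * c j) \<le> A i i * c i" if i: "i \<in> I" for i
    proof -
      have "(\<Sum>j\<in>I - {i}. \<bar>mat_prod I (mat_prod I D A) D i j\<bar>)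
          = c i * (\<Sum>j\<in>I - {i}. \<bar>A i j\<bar> * c j)"
        unfolding sum_distrib_left
        using i c by (intro sum.cong refl) (force simp: prod abs_mult less_imp_le)
      then show ?thesis using i c[OF i] by (simp add: prod)
    qed
    ultimately show ?thesis by (auto simp: diag_dominant_def)
  qed
  show ?thesis
  proof
    assume sdd: "scaled_diag_dominant I A"
    then have sym: ?sym by (simp add: scaled_diag_dominant_def)
    from sdd obtain D where D: "diagonal_on I D" "pos_def I D"
      "diag_dominant I (mat_prod I (mat_prod I D A) D)"
      by (auto simp: scaled_diag_dominant_def)
    have "0 < D i i" if "i \<in> I" for i
    proof -
      let ?u = "\<lambda>j. if j = i then 1 else 0"
      have "0 < quad_form I D ?u"
        using D(2) that by (auto simp: pos_def_def)
      then show ?thesis using quad_form_unit[OF assms that] by simp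
    qed
    with scale[OF D(1), of "\<lambda>i. D i i"] sym D(3) have "?P (\<lambda>i. D i i)" by blast
    then have "\<exists>c. ?P c" by (rule exI[of ?P])
    with sym show "?sym \<and> (\<exists>c. ?P c)" ..
  next
    assume "?sym \<and> (\<exists>c. ?P c)"
    then obtain c where sym: ?sym and c: "\<And>i. i \<in> I \<Longrightarrow> 0 < c i" and P: "?P c" by blast
    define D where "D i j = (if i = j then c i else 0)" for i j
    have diag: "diagonal_on I D" by (auto simp: diagonal_on_def D_def)
    have "quad_form I D u = (\<Sum>i\<in>I. c i * (u i)\<^sup>2)" for u
    proof -
      have "quad_form I D u = (\<Sum>i\<in>I. \<Sum>j\<in>I. if j = i then c i * (u i)\<^sup>2 else 0)"
        unfolding quad_form_def
        by (intro sum.cong refl) (auto simp: D_def power2_eq_square)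
      then show ?thesis using assms by simp
    qed
    moreover have "0 < (\<Sum>i\<in>I. c i * (u i)\<^sup>2)" if "i \<in> I" "u i \<noteq> 0" for u i
      using assms that c by (intro sum_pos2[of I i]) (auto simp: less_imp_le)
    ultimately have "pos_def I D" by (auto simp: pos_def_def symmetric_on_def D_def)
    with scale[OF diag, of c] sym c P diag show "scaled_diag_dominant I A"
      by (auto simp: scaled_diag_dominant_def D_def)
  qed
qed

lemma diag_dominant_imp_scaled:
  assumes "finite I" "diag_dominant I A"
  shows "scaled_diag_dominant I A"
  using assms by (auto simp: scaled_diag_dominant_iff diag_dominant_def intro!: exI[of _ "\<lambda>_. 1"])

text \<open>The scaled matrix is diagonally dominant, and the substitution \<open>u i / c i\<close>
  undoes the scaling in the quadratic form.\<close>

lemma scaled_diag_dominant_imp_pos_semidef: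
  assumes fin: "finite I" and "scaled_diag_dominant I A"
  shows "pos_semidef I A"
proof -
  from assms obtain c where sym: "symmetric_on I A" and c: "\<And>i. i \<in> I \<Longrightarrow> 0 < c i"
    and dom: "\<And>i. i \<in> I \<Longrightarrow> (\<Sum>j\<in>I - {i}. \<bar>A i j\<bar> * c j) \<le> A i i * c i"
    unfolding scaled_diag_dominant_iff[OF fin] by blast
  have "diag_dominant I (\<lambda>i j. c i * A i j * c j)"
    unfolding diag_dominant_def
  proof (intro conjI ballI)
    show "symmetric_on I (\<lambda>i j. c i * A i j * c j)"
      using sym by (auto simp: symmetric_on_def)
    fix i assume i: "i \<in> I"
    have "(\<Sum>j\<in>I - {i}. \<bar>c i * A i j * c j\<bar>) = c i * (\<Sum>j\<in>I - {i}. \<bar>A i j\<bar> * c j)"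
      unfolding sum_distrib_left
      using i c by (intro sum.cong refl) (force simp: abs_mult less_imp_le)
    then show "(\<Sum>j\<in>I - {i}. \<bar>c i * A i j * c j\<bar>) \<le> c i * A i i * c i"
      using dom[OF i] c[OF i] by simp
  qed
  then have psd: "pos_semidef I (\<lambda>i j. c i * A i j * c j)"
    by (rule diag_dominant_imp_pos_semidef[OF fin])
  have "quad_form I A u = quad_form I (\<lambda>i j. c i * A i j * c j) (\<lambda>i. u i / c i)" for u
    unfolding quad_form_def using c by (intro sum.cong refl) (force simp: field_simps)
  with psd sym show ?thesis by (simp add: pos_semidef_def)
qed

text \<open>The same scaling \<open>c\<close> works: the masked row \<open>i\<close> is dominated by
  \<open>M i i\<close> times the inequality for row \<open>i\<close> of \<open>A\<close>.\<close>

lemma scaled_diag_dominant_mask: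
  assumes fin: "finite I" and "scaled_diag_dominant I A" and M: "symmetric_on I M"
    and bound: "\<And>i j. i \<in> I \<Longrightarrow> j \<in> I \<Longrightarrow> \<bar>M i j\<bar> \<le> M i i"
  shows "scaled_diag_dominant I (\<lambda>i j. A i j * M i j)"
proof -
  from assms obtain c where sym: "symmetric_on I A" and c: "\<And>i. i \<in> I \<Longrightarrow> 0 < c i"
    and dom: "\<And>i. i \<in> I \<Longrightarrow> (\<Sum>j\<in>I - {i}. \<bar>A i j\<bar> * c j) \<le> A i i * c i"
    unfolding scaled_diag_dominant_iff[OF fin] by blast
  have "(\<Sum>j\<in>I - {i}. \<bar>A i j * M i j\<bar> * c j) \<le> A i i * M i i * c i" if i: "i \<in> I" for i
  proof -
    have nonneg: "0 \<le> M i i" using bound[OF i i] by simp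
    have "(\<Sum>j\<in>I - {i}. \<bar>A i j * M i j\<bar> * c j) \<le> (\<Sum>j\<in>I - {i}. M i i * (\<bar>A i j\<bar> * c j))"
    proof (rule sum_mono)
      fix j assume j: "j \<in> I - {i}"
      then have "\<bar>M i j\<bar> * (\<bar>A i j\<bar> * c j) \<le> M i i * (\<bar>A i j\<bar> * c j)"
        using bound[OF i, of j] c[of j] by (intro mult_right_mono) auto
      then show "\<bar>A i j * M i j\<bar> * c j \<le> M i i * (\<bar>A i j\<bar> * c j)"
        by (simp add: abs_mult mult_ac)
    qed
    also have "\<dots> \<le> M i i * (A i i * c i)"
      unfolding sum_distrib_left[symmetric] using dom[OF i] nonneg by (rule mult_left_mono)
    finally show ?thesis by (simp add: mult_ac)
  qed
  moreover have "symmetric_on I (\<lambda>i j. A i j * M i j)"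
    using sym M by (auto simp: symmetric_on_def)
  ultimately show ?thesis using c by (auto simp: scaled_diag_dominant_iff[OF fin])
qed

section \<open>Linear functionals on polynomials and Gram matrices\<close>

text \<open>The linear functional with value \<open>\<phi> \<alpha>\<close> on each monomial.
  Coefficient extraction and evaluation at a point are both special cases.\<close>

definition functional :: "(expnt \<Rightarrow> real) \<Rightarrow> rpoly \<Rightarrow> real" where
  "functional \<phi> p = (\<Sum>\<alpha>\<in>Poly_Mapping.keys p. Poly_Mapping.lookup p \<alpha> * \<phi> \<alpha>)"

lemma functional_superset:
  assumes "finite A" "Poly_Mapping.keys p \<subseteq> A"
  shows "functional \<phi> p = (\<Sum>\<alpha>\<in>A. Poly_Mapping.lookup p \<alpha> * \<phi> \<alpha>)"
  unfolding functional_def using assms by (intro sum.mono_neutral_left) (auto simp: in_keys_iff)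

lemma functional_add: "functional \<phi> (p + q) = functional \<phi> p + functional \<phi> q"
proof -
  let ?A = "Poly_Mapping.keys p \<union> Poly_Mapping.keys q"
  have "Poly_Mapping.keys (p + q) \<subseteq> ?A" by (rule keys_add)
  then show ?thesis
    by (simp add: functional_superset[of ?A] lookup_add algebra_simps sum.distrib)
qed

lemma functional_0: "functional \<phi> 0 = 0"
  by (simp add: functional_def)

lemma functional_sum: "functional \<phi> (\<Sum>i\<in>A. f i) = (\<Sum>i\<in>A. functional \<phi> (f i))"
  by (induction A rule: infinite_finite_induct) (simp_all add: functional_add functional_0)

lemma functional_single: "functional \<phi> (Poly_Mapping.single \<alpha> c) = c * \<phi> \<alpha>"
  by (simp add: functional_superset[of "{\<alpha>}"])

lemma lookup_eq_functional:
  "Poly_Mapping.lookup p \<alpha> = functional (\<lambda>\<beta>. if \<beta> = \<alpha> then 1 else 0) p"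
  by (simp add: functional_superset[of "insert \<alpha> (Poly_Mapping.keys p)"] subset_insertI
      if_distrib[of "\<lambda>x. _ * x"] cong: if_cong)

section \<open>Gram matrices and sums of squares\<close>

definition gram_poly :: "nat \<Rightarrow> nat \<Rightarrow> expnt rmat \<Rightarrow> rpoly" where
  "gram_poly n d Q = (\<Sum>\<beta>\<in>expnts n d. \<Sum>\<gamma>\<in>expnts n d. Poly_Mapping.single (\<beta> + \<gamma>) (Q \<beta> \<gamma>))"

lemma gram_matrix_iff:
  "gram_matrix n d p Q \<longleftrightarrow> symmetric_on (expnts n d) Q \<and> p = gram_poly n d Q"
  by (simp add: gram_matrix_def gram_poly_def monomial_def const_poly_def mult_single)

lemma functional_gram_poly:
  "functional \<phi> (gram_poly n d Q) = (\<Sum>\<beta>\<in>expnts n d. \<Sum>\<gamma>\<in>expnts n d. Q \<beta> \<gamma> * \<phi> (\<beta> + \<gamma>))"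
  by (simp add: gram_poly_def functional_sum functional_single)

lemma lookup_gram_poly:
  "Poly_Mapping.lookup (gram_poly n d Q) \<alpha>
    = (\<Sum>\<beta>\<in>expnts n d. \<Sum>\<gamma>\<in>expnts n d. if \<beta> + \<gamma> = \<alpha> then Q \<beta> \<gamma> else 0)"
  unfolding lookup_eq_functional functional_gram_poly by (intro sum.cong refl) auto

lemma expnts_add:
  assumes "\<beta> \<in> expnts n d" "\<gamma> \<in> expnts n e"
  shows "\<beta> + \<gamma> \<in> expnts n (d + e)"
proof -
  have "Poly_Mapping.keys (\<beta> + \<gamma>) \<subseteq> {1..n}"
    using assms keys_add[of \<beta> \<gamma>] unfolding expnts_def by blast
  with assms show ?thesis by (simp add: expnts_def lookup_add sum.distrib)
qed

lemma gram_poly_in_polys: "gram_poly n d Q \<in> polys n (2 * d)"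
proof -
  have "Poly_Mapping.lookup (gram_poly n d Q) \<alpha> = 0" if "\<alpha> \<notin> expnts n (2 * d)" for \<alpha>
    unfolding lookup_gram_poly
    using that expnts_add[of _ n d _ d] by (intro sum.neutral ballI) (auto simp: mult_2)
  then show ?thesis by (auto simp: polys_def in_keys_iff)
qed

lemma polys_expansion:
  assumes "q \<in> polys n d"
  shows "q = (\<Sum>\<beta>\<in>expnts n d. Poly_Mapping.single \<beta> (Poly_Mapping.lookup q \<beta>))"
proof (rule poly_mapping_eqI)
  fix \<alpha>
  have "Poly_Mapping.lookup q \<alpha> = 0" if "\<alpha> \<notin> expnts n d"
    using assms that by (auto simp: polys_def in_keys_iff)
  then show "Poly_Mapping.lookup q \<alpha>
      = Poly_Mapping.lookup (\<Sum>\<beta>\<in>expnts n d. Poly_Mapping.single \<beta> (Poly_Mapping.lookup q \<beta>)) \<alpha>"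
    using finite_expnts[of n d] by (auto simp: lookup_sum lookup_single when_def)
qed

lemma sum_singles_in_polys: "(\<Sum>\<beta>\<in>expnts n d. Poly_Mapping.single \<beta> (v \<beta>)) \<in> polys n d"
  using finite_expnts[of n d]
  by (auto simp: polys_def in_keys_iff lookup_sum lookup_single when_def split: if_splits)

lemma gram_poly_rank_one:
  "gram_poly n d (\<lambda>\<beta> \<gamma>. v \<beta> * v \<gamma>) = (\<Sum>\<beta>\<in>expnts n d. Poly_Mapping.single \<beta> (v \<beta>))\<^sup>2"
  by (simp add: gram_poly_def power2_eq_square sum_product mult_single)

lemma gram_poly_add: "gram_poly n d (\<lambda>\<beta> \<gamma>. P \<beta> \<gamma> + Q \<beta> \<gamma>) = gram_poly n d P + gram_poly n d Q"
  by (simp add: gram_poly_def single_add sum.distrib)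

lemma gram_poly_cong:
  assumes "\<And>\<beta> \<gamma>. \<beta> \<in> expnts n d \<Longrightarrow> \<gamma> \<in> expnts n d \<Longrightarrow> P \<beta> \<gamma> = Q \<beta> \<gamma>"
  shows "gram_poly n d P = gram_poly n d Q"
  unfolding gram_poly_def using assms by (intro sum.cong refl) auto

lemma gram_poly_sum_rank_one:
  "gram_poly n d (\<lambda>\<beta> \<gamma>. \<Sum>v\<leftarrow>vs. v \<beta> * v \<gamma>)
    = (\<Sum>v\<leftarrow>vs. (\<Sum>\<beta>\<in>expnts n d. Poly_Mapping.single \<beta> (v \<beta>))\<^sup>2)"
proof (induction vs)
  case Nil
  then show ?case by (simp add: gram_poly_def)
next
  case (Cons v vs)
  then show ?case by (simp add: gram_poly_add gram_poly_rank_one)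
qed

lemma gram_matrix_square:
  assumes "q \<in> polys n d"
  shows "gram_matrix n d (q\<^sup>2) (\<lambda>\<beta> \<gamma>. Poly_Mapping.lookup q \<beta> * Poly_Mapping.lookup q \<gamma>)"
  by (simp add: gram_matrix_iff gram_poly_rank_one symmetric_on_def polys_expansion[OF assms, symmetric])

text \<open>Squares correspond to rank-one Gram matrices built from their coefficient vectors, so a
  rank-one decomposition of \<open>Q\<close> is a sum of squares and conversely.\<close>

lemma SOS_iff_pos_semidef_gram:
  "p \<in> SOS n d \<longleftrightarrow> (\<exists>Q. gram_matrix n d p Q \<and> pos_semidef (expnts n d) Q)"
proof
  assume "p \<in> SOS n d"
  then obtain qs where qs: "set qs \<subseteq> polys n d" and p: "p = (\<Sum>q\<leftarrow>qs. q\<^sup>2)"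
    by (auto simp: SOS_def)
  let ?Q = "\<lambda>\<beta> \<gamma>. \<Sum>v\<leftarrow>map Poly_Mapping.lookup qs. v \<beta> * v \<gamma>"
  have "gram_poly n d ?Q
      = (\<Sum>q\<leftarrow>qs. (\<Sum>\<beta>\<in>expnts n d. Poly_Mapping.single \<beta> (Poly_Mapping.lookup q \<beta>))\<^sup>2)"
    unfolding gram_poly_sum_rank_one by (simp add: o_def)
  also have "\<dots> = p"
    unfolding p using qs polys_expansion
    by (intro arg_cong[of _ _ sum_list] map_cong refl) (metis subsetD)
  finally have "p = gram_poly n d ?Q" ..
  moreover have "pos_semidef (expnts n d) ?Q"
    by (rule sum_rank_one_imp_pos_semidef)
  ultimately show "\<exists>Q. gram_matrix n d p Q \<and> pos_semidef (expnts n d) Q"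
    unfolding gram_matrix_iff pos_semidef_def by blast
next
  assume "\<exists>Q. gram_matrix n d p Q \<and> pos_semidef (expnts n d) Q"
  then obtain Q where p: "p = gram_poly n d Q" and Q: "pos_semidef (expnts n d) Q"
    by (auto simp: gram_matrix_iff)
  obtain vs where "\<forall>\<beta>\<in>expnts n d. \<forall>\<gamma>\<in>expnts n d. Q \<beta> \<gamma> = (\<Sum>v\<leftarrow>vs. v \<beta> * v \<gamma>)"
    using pos_semidef_imp_sum_rank_one[OF finite_expnts Q] by blast
  then have "p = gram_poly n d (\<lambda>\<beta> \<gamma>. \<Sum>v\<leftarrow>vs. v \<beta> * v \<gamma>)"
    unfolding p by (intro gram_poly_cong) auto
  then have "p = (\<Sum>q\<leftarrow>map (\<lambda>v. \<Sum>\<beta>\<in>expnts n d. Poly_Mapping.single \<beta> (v \<beta>)) vs. q\<^sup>2)"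
    by (simp add: gram_poly_sum_rank_one o_def)
  moreover have "set (map (\<lambda>v. \<Sum>\<beta>\<in>expnts n d. Poly_Mapping.single \<beta> (v \<beta>)) vs) \<subseteq> polys n d"
    using sum_singles_in_polys by auto
  moreover have "p \<in> polys n (2 * d)"
    using gram_poly_in_polys p by simp
  ultimately show "p \<in> SOS n d"
    unfolding SOS_def mem_Collect_eq by blast
qed

section \<open>Sparsity\<close>

text \<open>Both the \<open>csp\<close> condition on coefficients and the zero pattern in
  \<open>SSOS\<close> reduce to this clique condition on one exponent, the latter at
  \<open>\<beta> + \<gamma>\<close>.\<close>

definition compliant :: "nat \<Rightarrow> (nat \<times> nat) set \<Rightarrow> expnt \<Rightarrow> bool" where
  "compliant n E \<alpha> \<longleftrightarrow> (\<forall>i\<in>{1..n}. \<forall>j\<in>{1..n}. i \<noteq> j \<and> Poly_Mapping.lookup \<alpha> i \<noteq> 0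
      \<and> Poly_Mapping.lookup \<alpha> j \<noteq> 0 \<longrightarrow> (i, j) \<in> E)"

lemma compliant_addD:
  assumes "compliant n E (\<beta> + \<gamma>)"
  shows "compliant n E \<beta>"
  using assms by (auto simp: compliant_def lookup_add)

lemma compliant_double: "compliant n E (\<beta> + \<beta>) \<longleftrightarrow> compliant n E \<beta>"
  by (auto simp: compliant_def lookup_add)

lemma sparse_polys_iff:
  "p \<in> sparse_polys n m E \<longleftrightarrow>
    p \<in> polys n m \<and> (\<forall>\<alpha>. Poly_Mapping.lookup p \<alpha> \<noteq> 0 \<longrightarrow> compliant n E \<alpha>)"
proof -
  have "symmetric_on {1..n} (csp p)"
    by (auto simp: symmetric_on_def csp_def)
  moreover have "csp p i j = 0 \<and> csp p j i = 0 \<longleftrightarrow> i \<noteq> j \<and> (\<forall>\<alpha>. Poly_Mapping.lookup p \<alpha> \<noteq> 0 \<longrightarrow>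
      \<not> (Poly_Mapping.lookup \<alpha> i \<noteq> 0 \<and> Poly_Mapping.lookup \<alpha> j \<noteq> 0))" for i j
    by (auto simp: csp_def Suc_le_eq)
  moreover have "(i, j) \<in> with_loops n E \<longleftrightarrow> (i, j) \<in> E \<or> i = j" if "i \<in> {1..n}" for i j
    using that by (auto simp: with_loops_def)
  ultimately have "csp p \<in> sparse_sym_mats n E \<longleftrightarrow>
      (\<forall>i\<in>{1..n}. \<forall>j\<in>{1..n}. (i, j) \<notin> E \<and> i \<noteq> j \<longrightarrow>
        (\<forall>\<alpha>. Poly_Mapping.lookup p \<alpha> \<noteq> 0 \<longrightarrow>
          \<not> (Poly_Mapping.lookup \<alpha> i \<noteq> 0 \<and> Poly_Mapping.lookup \<alpha> j \<noteq> 0)))"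
    by (simp add: sparse_sym_mats_def)
  also have "\<dots> \<longleftrightarrow> (\<forall>\<alpha>. Poly_Mapping.lookup p \<alpha> \<noteq> 0 \<longrightarrow> compliant n E \<alpha>)"
    unfolding compliant_def by blast
  finally show ?thesis by (simp add: sparse_polys_def)
qed

lemma SSOS_iff:
  "p \<in> SSOS n d E \<longleftrightarrow> (\<exists>Q. gram_matrix n d p Q \<and> pos_semidef (expnts n d) Q \<and>
    (\<forall>\<beta>\<in>expnts n d. \<forall>\<gamma>\<in>expnts n d. \<not> compliant n E (\<beta> + \<gamma>) \<longrightarrow> Q \<beta> \<gamma> = 0))"
proof -
  have "\<not> compliant n E (\<beta> + \<gamma>) \<longleftrightarrow> (\<exists>i\<in>{1..n}. \<exists>j\<in>{1..n}. i \<noteq> j \<and> (i, j) \<notin> E \<and>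
      Poly_Mapping.lookup \<beta> i + Poly_Mapping.lookup \<gamma> i \<noteq> 0 \<and>
      Poly_Mapping.lookup \<beta> j + Poly_Mapping.lookup \<gamma> j \<noteq> 0)" for \<beta> \<gamma>
    unfolding compliant_def lookup_add by blast
  moreover have "p \<in> polys n (2 * d)" if "gram_matrix n d p Q" for Q
    using that gram_poly_in_polys by (simp add: gram_matrix_iff)
  ultimately show ?thesis
    unfolding SSOS_def by auto
qed

text \<open>The examples that separate the first three cones are single squares; the rank-one Gram
  matrix of a square is already sparse under this condition.\<close>

lemma square_in_SSOS:
  assumes "q \<in> polys n d"
    and "\<And>\<beta> \<gamma>. Poly_Mapping.lookup q \<beta> \<noteq> 0 \<Longrightarrow> Poly_Mapping.lookup q \<gamma> \<noteq> 0 \<Longrightarrow> compliant n E (\<beta> + \<gamma>)"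
  shows "q\<^sup>2 \<in> SSOS n d E"
proof -
  have "pos_semidef (expnts n d) (\<lambda>\<beta> \<gamma>. Poly_Mapping.lookup q \<beta> * Poly_Mapping.lookup q \<gamma>)"
    using sum_rank_one_imp_pos_semidef[of "expnts n d" "[Poly_Mapping.lookup q]"] by simp
  then show ?thesis
    unfolding SSOS_iff using gram_matrix_square[OF assms(1)] assms(2) by fastforce
qed

text \<open>Every Gram entry that contributes to a forbidden coefficient is zero.\<close>

lemma SSOS_subset_SOS_sparse: "SSOS n d E \<subseteq> SOS_sparse n d E"
proof
  fix p assume "p \<in> SSOS n d E"
  then obtain Q where Q: "gram_matrix n d p Q" "pos_semidef (expnts n d) Q"
    "\<forall>\<beta>\<in>expnts n d. \<forall>\<gamma>\<in>expnts n d. \<not> compliant n E (\<beta> + \<gamma>) \<longrightarrow> Q \<beta> \<gamma> = 0"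
    unfolding SSOS_iff by blast
  have p: "p = gram_poly n d Q" using Q(1) by (simp add: gram_matrix_iff)
  have "Poly_Mapping.lookup p \<alpha> = 0" if "\<not> compliant n E \<alpha>" for \<alpha>
    unfolding p lookup_gram_poly using Q(3) that by (intro sum.neutral ballI) auto
  then have "p \<in> sparse_polys n (2 * d) E"
    using gram_poly_in_polys p unfolding sparse_polys_iff by blast
  then show "p \<in> SOS_sparse n d E"
    using Q SOS_iff_pos_semidef_gram[of p n d] unfolding SOS_sparse_def by blast
qed

text \<open>The mask depends on \<open>\<beta> + \<gamma>\<close> only, so it keeps or deletes all
  contributions to a coefficient together, and the deleted coefficients were zero by
  sparsity.\<close>

lemma gram_poly_compliant_mask:
  assumes "gram_poly n d Q \<in> sparse_polys n (2 * d) E"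
  shows "gram_poly n d (\<lambda>\<beta> \<gamma>. Q \<beta> \<gamma> * of_bool (compliant n E (\<beta> + \<gamma>))) = gram_poly n d Q"
proof (rule poly_mapping_eqI)
  fix \<alpha>
  show "Poly_Mapping.lookup (gram_poly n d (\<lambda>\<beta> \<gamma>. Q \<beta> \<gamma> * of_bool (compliant n E (\<beta> + \<gamma>)))) \<alpha>
      = Poly_Mapping.lookup (gram_poly n d Q) \<alpha>"
  proof (cases "compliant n E \<alpha>")
    case True
    then show ?thesis
      unfolding lookup_gram_poly by (intro sum.cong refl) auto
  next
    case False
    then have "Poly_Mapping.lookup (gram_poly n d Q) \<alpha> = 0"
      using assms by (auto simp: sparse_polys_iff)
    moreover have "Poly_Mapping.lookup
        (gram_poly n d (\<lambda>\<beta> \<gamma>. Q \<beta> \<gamma> * of_bool (compliant n E (\<beta> + \<gamma>)))) \<alpha> = 0"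
      unfolding lookup_gram_poly using False by (intro sum.neutral ballI) auto
    ultimately show ?thesis by simp
  qed
qed

text \<open>
  Deleting the forbidden entries does not change a sparse polynomial.  It keeps the matrix
  scaled diagonally dominant, because a forbidden diagonal entry forbids its whole row.
\<close>

lemma SDSOS_sparse_subset_SSOS: "SDSOS_sparse n d E \<subseteq> SSOS n d E"
proof
  fix p assume p: "p \<in> SDSOS_sparse n d E"
  then obtain Q where Q: "gram_matrix n d p Q" "scaled_diag_dominant (expnts n d) Q"
    by (auto simp: SDSOS_sparse_def SDSOS_def)
  define R where "R \<beta> \<gamma> = Q \<beta> \<gamma> * of_bool (compliant n E (\<beta> + \<gamma>))" for \<beta> \<gamma>
  have "scaled_diag_dominant (expnts n d) R"
    unfolding R_def
    using compliant_addD[of n E]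
    by (intro scaled_diag_dominant_mask finite_expnts Q)
      (auto simp: symmetric_on_def add.commute compliant_double)
  then have psd: "pos_semidef (expnts n d) R"
    by (rule scaled_diag_dominant_imp_pos_semidef[OF finite_expnts])
  moreover have "gram_poly n d R = p"
    using p Q(1) gram_poly_compliant_mask[of n d Q E]
    unfolding R_def by (auto simp: SDSOS_sparse_def gram_matrix_iff)
  moreover have "R \<beta> \<gamma> = 0" if "\<not> compliant n E (\<beta> + \<gamma>)" for \<beta> \<gamma>
    using that by (simp add: R_def)
  ultimately show "p \<in> SSOS n d E"
    unfolding SSOS_iff gram_matrix_iff pos_semidef_def by blast
qed

lemma DSOS_sparse_subset_SDSOS_sparse: "DSOS_sparse n d E \<subseteq> SDSOS_sparse n d E"
  using diag_dominant_imp_scaled[OF finite_expnts]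
  by (auto simp: DSOS_sparse_def SDSOS_sparse_def DSOS_def SDSOS_def)

section \<open>Equality for full patterns and for degree one\<close>

lemma SSOS_eq_SOS_sparse_if_full:
  assumes "full_pattern n E"
  shows "SSOS n d E = SOS_sparse n d E"
proof -
  have "compliant n E \<alpha>" for \<alpha>
    using assms by (auto simp: compliant_def full_pattern_def)
  then have "SOS n d \<subseteq> SSOS n d E"
    by (auto simp: SOS_iff_pos_semidef_gram SSOS_iff)
  then show ?thesis
    using SSOS_subset_SOS_sparse[of n d E] by (auto simp: SOS_sparse_def)
qed

abbreviation var :: "nat \<Rightarrow> expnt" where
  "var i \<equiv> Poly_Mapping.single i (Suc 0)"

lemma expnts_1D:
  assumes "\<beta> \<in> expnts n 1" "Poly_Mapping.lookup \<beta> i \<noteq> 0"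
  shows "\<beta> = var i"
proof (rule poly_mapping_eqI)
  fix j
  have keys: "Poly_Mapping.keys \<beta> \<subseteq> {1..n}" and sum: "(\<Sum>k\<in>{1..n}. Poly_Mapping.lookup \<beta> k) \<le> 1"
    using assms unfolding expnts_def by blast+
  have i: "i \<in> {1..n}" using keys assms(2) by (metis in_keys_iff subsetD)
  have "(\<Sum>k\<in>{1..n}. Poly_Mapping.lookup \<beta> k)
      = Poly_Mapping.lookup \<beta> i + (\<Sum>k\<in>{1..n} - {i}. Poly_Mapping.lookup \<beta> k)"
    using i by (intro sum.remove) auto
  then have one: "Poly_Mapping.lookup \<beta> i = 1"
    and "(\<Sum>k\<in>{1..n} - {i}. Poly_Mapping.lookup \<beta> k) = 0"
    using sum assms(2) by linarith+
  then have "Poly_Mapping.lookup \<beta> k = 0" if "k \<in> {1..n}" "k \<noteq> i" for k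
    using that by simp
  moreover have "Poly_Mapping.lookup \<beta> j = 0" if "j \<notin> {1..n}"
    using keys that by (auto simp: in_keys_iff)
  ultimately show "Poly_Mapping.lookup \<beta> j = Poly_Mapping.lookup (var i) j"
    using one by (cases "j = i") (auto simp: lookup_single when_def)
qed

text \<open>
  In degree \<open>1\<close> a product \<open>x\<^sub>i x\<^sub>j\<close> with \<open>i \<noteq> j\<close> arises from exactly two entries of a Gram
  matrix, which are equal by symmetry.
\<close>

lemma SSOS_eq_SOS_sparse_if_quadratic: "SSOS n 1 E = SOS_sparse n 1 E"
proof (rule antisym[OF SSOS_subset_SOS_sparse], rule subsetI)
  fix p assume "p \<in> SOS_sparse n 1 E"
  then obtain Q where Q: "gram_matrix n 1 p Q" "pos_semidef (expnts n 1) Q"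
    and sparse: "p \<in> sparse_polys n (2 * 1) E"
    using SOS_iff_pos_semidef_gram[of p n 1] unfolding SOS_sparse_def by blast
  have p: "p = gram_poly n 1 Q" and sym: "symmetric_on (expnts n 1) Q"
    using Q(1) by (simp_all add: gram_matrix_iff)
  have "Q \<beta> \<gamma> = 0"
    if \<beta>: "\<beta> \<in> expnts n 1" and \<gamma>: "\<gamma> \<in> expnts n 1" and nc: "\<not> compliant n E (\<beta> + \<gamma>)" for \<beta> \<gamma>
  proof -
    from nc obtain i j where ij: "i \<noteq> j" "Poly_Mapping.lookup (\<beta> + \<gamma>) i \<noteq> 0"
      "Poly_Mapping.lookup (\<beta> + \<gamma>) j \<noteq> 0"
      by (auto simp: compliant_def)
    have neq: "var i \<noteq> var j" using ij(1) by (metis lookup_single_eq lookup_single_not_eq Zero_not_Suc)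
    have pair: "\<beta>' = var i \<and> \<gamma>' = var j \<or> \<beta>' = var j \<and> \<gamma>' = var i"
      if "\<beta>' \<in> expnts n 1" "\<gamma>' \<in> expnts n 1" "\<beta>' + \<gamma>' = \<beta> + \<gamma>" for \<beta>' \<gamma>'
    proof -
      have "Poly_Mapping.lookup \<beta>' i \<noteq> 0 \<or> Poly_Mapping.lookup \<gamma>' i \<noteq> 0"
        "Poly_Mapping.lookup \<beta>' j \<noteq> 0 \<or> Poly_Mapping.lookup \<gamma>' j \<noteq> 0"
        using ij that(3) by (metis add_0 lookup_add)+
      then show ?thesis using expnts_1D that(1,2) neq by metis
    qed
    have \<beta>\<gamma>: "\<beta> \<noteq> \<gamma>" using pair[OF \<beta> \<gamma> refl] neq by auto
    have "0 = Poly_Mapping.lookup p (\<beta> + \<gamma>)"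
      using sparse nc by (auto simp: sparse_polys_iff)
    \<comment> \<open>The exponent splits only as \<open>\<beta> + \<gamma>\<close> and
      \<open>\<gamma> + \<beta>\<close>; as \<open>\<beta>\<close> and \<open>\<gamma>\<close>
      differ, the two indicators never overlap.\<close>
    also have "\<dots> = (\<Sum>\<beta>'\<in>expnts n 1. \<Sum>\<gamma>'\<in>expnts n 1.
        (if \<beta>' = \<beta> \<and> \<gamma>' = \<gamma> then Q \<beta> \<gamma> else 0) + (if \<beta>' = \<gamma> \<and> \<gamma>' = \<beta> then Q \<gamma> \<beta> else 0))"
      unfolding p lookup_gram_poly
      using pair pair[OF \<beta> \<gamma> refl] \<beta>\<gamma> by (intro sum.cong refl) (auto simp: add.commute)
    also have "\<dots> = Q \<beta> \<gamma> + Q \<gamma> \<beta>"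
    proof -
      have "(\<Sum>\<beta>'\<in>expnts n 1. \<Sum>\<gamma>'\<in>expnts n 1. if \<beta>' = \<mu> \<and> \<gamma>' = \<nu> then c else 0) = c"
        if "\<mu> \<in> expnts n 1" "\<nu> \<in> expnts n 1" for \<mu> \<nu> and c :: real
      proof -
        have "(\<Sum>\<beta>'\<in>expnts n 1. \<Sum>\<gamma>'\<in>expnts n 1. if \<beta>' = \<mu> \<and> \<gamma>' = \<nu> then c else 0)
            = (\<Sum>\<beta>'\<in>expnts n 1. if \<beta>' = \<mu> then (\<Sum>\<gamma>'\<in>expnts n 1. if \<gamma>' = \<nu> then c else 0) else 0)"
          by (intro sum.cong refl) auto
        then show ?thesis using that finite_expnts by simp
      qed
      then show ?thesis using \<beta> \<gamma> by (simp add: sum.distrib)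
    qed
    finally show ?thesis using sym \<beta> \<gamma> by (simp add: symmetric_on_def)
  qed
  then show "p \<in> SSOS n 1 E" unfolding SSOS_iff using Q by blast
qed

section \<open>Separating examples\<close>

lemma zero_in_expnts: "0 \<in> expnts n d"
  by (simp add: expnts_def)

lemma single_in_expnts:
  assumes "i \<in> {1..n}" "k \<le> d"
  shows "Poly_Mapping.single i k \<in> expnts n d"
  using assms by (simp add: expnts_def lookup_single when_def)

lemma polys_add: "p \<in> polys n m \<Longrightarrow> q \<in> polys n m \<Longrightarrow> p + q \<in> polys n m"
  using keys_add[of p q] unfolding polys_def mem_Collect_eq by (meson Un_least order_trans)

lemma polys_single: "\<alpha> \<in> expnts n m \<Longrightarrow> Poly_Mapping.single \<alpha> c \<in> polys n m"
  by (simp add: polys_def)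

lemma square_in_polys: "q \<in> polys n d \<Longrightarrow> q\<^sup>2 \<in> polys n (2 * d)"
  using gram_matrix_square[of q n d] gram_poly_in_polys unfolding gram_matrix_iff by metis

lemma compliant_edge:
  assumes "(a, b) \<in> E" "(b, a) \<in> E" "\<And>m. Poly_Mapping.lookup \<alpha> m \<noteq> 0 \<Longrightarrow> m = a \<or> m = b"
  shows "compliant n E \<alpha>"
  using assms unfolding compliant_def by blast

lemma compliant_one_variable:
  assumes "\<And>m. Poly_Mapping.lookup \<alpha> m \<noteq> 0 \<Longrightarrow> m = a"
  shows "compliant n E \<alpha>"
  using assms unfolding compliant_def by blast

section \<open>Strictness of the first two inclusions\<close>

text \<open>The functional is additive in the exponent up to the constant \<open>1\<close>; half of
  it goes to each of \<open>\<beta>\<close> and \<open>\<gamma>\<close>, which gives nonnegative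
  weights for a diagonally dominant matrix.\<close>

lemma DSOS_functional_nonneg:
  assumes "p \<in> DSOS n d"
  shows "0 \<le> functional (\<lambda>\<alpha>. 1 + real (Poly_Mapping.lookup \<alpha> i)) p"
proof -
  obtain Q where p: "p = gram_poly n d Q" and Q: "diag_dominant (expnts n d) Q"
    using assms by (auto simp: DSOS_def gram_matrix_iff)
  have "0 \<le> (\<Sum>\<beta>\<in>expnts n d. \<Sum>\<gamma>\<in>expnts n d. Q \<beta> \<gamma> *
      ((1/2 + real (Poly_Mapping.lookup \<beta> i)) + (1/2 + real (Poly_Mapping.lookup \<gamma> i))))"
    by (intro diag_dominant_weighted_sum_nonneg finite_expnts Q) auto
  also have "\<dots> = functional (\<lambda>\<alpha>. 1 + real (Poly_Mapping.lookup \<alpha> i)) p"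
    unfolding p functional_gram_poly by (simp add: lookup_add add_ac)
  finally show ?thesis .
qed

text \<open>The functional is the quadratic form of the masked Gram matrix at the all-ones
  vector.\<close>

lemma SDSOS_functional_nonneg:
  assumes "p \<in> SDSOS n d" "\<And>\<alpha>. \<bar>\<phi> \<alpha>\<bar> \<le> 1" "\<And>\<beta>. \<phi> (\<beta> + \<beta>) = 1"
  shows "0 \<le> functional \<phi> p"
proof -
  obtain Q where p: "p = gram_poly n d Q" and Q: "scaled_diag_dominant (expnts n d) Q"
    using assms(1) by (auto simp: SDSOS_def gram_matrix_iff)
  have "scaled_diag_dominant (expnts n d) (\<lambda>\<beta> \<gamma>. Q \<beta> \<gamma> * \<phi> (\<beta> + \<gamma>))"
    using assms(2,3)
    by (intro scaled_diag_dominant_mask finite_expnts Q) (auto simp: symmetric_on_def add.commute)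
  then have "0 \<le> quad_form (expnts n d) (\<lambda>\<beta> \<gamma>. Q \<beta> \<gamma> * \<phi> (\<beta> + \<gamma>)) (\<lambda>_. 1)"
    using scaled_diag_dominant_imp_pos_semidef[OF finite_expnts] unfolding pos_semidef_def by blast
  then show ?thesis
    by (simp add: p functional_gram_poly quad_form_def)
qed

text \<open>
  The polynomial \<open>(2 - x\<^sub>1)\<^sup>2\<close> has a scaled diagonally dominant Gram matrix, but the
  functional \<open>L(x\<^sup>\<alpha>) = 1 + \<alpha>\<^sub>1\<close>, which is nonnegative on \<open>DSOS\<close>, takes the value \<open>-1\<close> there.
\<close>

lemma DSOS_sparse_neq_SDSOS_sparse:
  assumes "1 \<le> n" "1 \<le> d"
  shows "DSOS_sparse n d E \<noteq> SDSOS_sparse n d E"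
proof -
  define e where "e = var 1"
  define q :: rpoly where "q = Poly_Mapping.single 0 2 + Poly_Mapping.single e (- 1)"
  have lookup_e: "Poly_Mapping.lookup e m = (if m = 1 then 1 else 0)" for m
    by (simp add: e_def lookup_single when_def)
  have "e \<in> expnts n d" unfolding e_def using assms by (intro single_in_expnts) auto
  moreover have "e \<noteq> 0" using lookup_e[of 1] by auto
  ultimately have e: "e \<in> expnts n d" "e \<noteq> 0" .
  have q: "q \<in> polys n d"
    unfolding q_def by (intro polys_add polys_single zero_in_expnts e)
  have lookup_q: "Poly_Mapping.lookup q \<beta> = (if \<beta> = 0 then 2 else if \<beta> = e then - 1 else 0)" for \<beta>
    unfolding q_def lookup_add lookup_single when_def using e(2) by auto
  have "q\<^sup>2 \<in> SSOS n d E"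
    by (intro square_in_SSOS q compliant_one_variable[of _ 1])
      (auto simp: lookup_q lookup_e lookup_add split: if_splits)
  then have "q\<^sup>2 \<in> sparse_polys n (2 * d) E"
    using SSOS_subset_SOS_sparse[of n d E] unfolding SOS_sparse_def by blast
  moreover have "scaled_diag_dominant (expnts n d)
      (\<lambda>\<beta> \<gamma>. Poly_Mapping.lookup q \<beta> * Poly_Mapping.lookup q \<gamma>)"
    unfolding scaled_diag_dominant_iff[OF finite_expnts]
  \<comment> \<open>On \<open>0, e\<close> the matrix has rows \<open>(4, -2)\<close> and
    \<open>(-2, 1)\<close>; its kernel vector \<open>(1, 2)\<close> serves as scaling and makes both
    rows tight. All other rows vanish.\<close>
  proof (intro conjI exI[of _ "\<lambda>\<beta>. if \<beta> = e then 2 else 1"] ballI)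
    let ?c = "\<lambda>\<beta>. if \<beta> = e then 2 else (1::real)"
    fix \<beta> assume "\<beta> \<in> expnts n d"
    have "(\<Sum>\<gamma>\<in>expnts n d - {\<beta>}. \<bar>Poly_Mapping.lookup q \<beta> * Poly_Mapping.lookup q \<gamma>\<bar> * ?c \<gamma>)
        = (\<Sum>\<gamma>\<in>{0, e} - {\<beta>}. \<bar>Poly_Mapping.lookup q \<beta> * Poly_Mapping.lookup q \<gamma>\<bar> * ?c \<gamma>)"
      using finite_expnts e(1) zero_in_expnts[of n d]
      by (intro sum.mono_neutral_right) (auto simp: lookup_q)
    also have "\<dots> \<le> Poly_Mapping.lookup q \<beta> * Poly_Mapping.lookup q \<beta> * ?c \<beta>"
    proof -
      consider "\<beta> = 0" | "\<beta> = e" | "\<beta> \<noteq> 0" "\<beta> \<noteq> e" by blast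
      then show ?thesis
      proof cases
        case 1
        then have "{0, e} - {\<beta>} = {e}" using e(2) by auto
        with 1 e(2) show ?thesis by (simp add: lookup_q)
      next
        case 2
        then have "{0, e} - {\<beta>} = {0}" using e(2) by auto
        with 2 e(2) show ?thesis by (simp add: lookup_q)
      next
        case 3
        then have "{0, e} - {\<beta>} = {0, e}" by auto
        with 3 show ?thesis by (simp add: lookup_q)
      qed
    qed
    finally show "(\<Sum>\<gamma>\<in>expnts n d - {\<beta>}. \<bar>Poly_Mapping.lookup q \<beta> * Poly_Mapping.lookup q \<gamma>\<bar> * ?c \<gamma>)
        \<le> Poly_Mapping.lookup q \<beta> * Poly_Mapping.lookup q \<beta> * ?c \<beta>" .
  qed (auto simp: symmetric_on_def)
  ultimately have "q\<^sup>2 \<in> SDSOS_sparse n d E"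
    using gram_matrix_square[OF q] square_in_polys[OF q]
    unfolding SDSOS_sparse_def SDSOS_def by blast
  moreover have "functional (\<lambda>\<alpha>. 1 + real (Poly_Mapping.lookup \<alpha> 1)) (q\<^sup>2) = - 1"
    unfolding q_def power2_eq_square distrib_left distrib_right mult_single functional_add
      functional_single lookup_add lookup_e
    by simp
  then have "q\<^sup>2 \<notin> DSOS n d"
    using DSOS_functional_nonneg[of "q\<^sup>2" n d 1] by auto
  ultimately show ?thesis
    unfolding DSOS_sparse_def by blast
qed

text \<open>In one variable, \<open>(1 + 2 x - x^2)^2 = 1 + 4 x + 2 x^2 - 4 x^3 + x^4\<close>.
  Flipping the sign of \<open>x\<close> alone is admissible, as its exponent is odd, and gives
  \<open>1 - 4 + 2 - 4 + 1 = -4\<close>.\<close>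

lemma SDSOS_sparse_neq_SSOS_if_quartic:
  assumes "1 \<le> n" "2 \<le> d"
  shows "SDSOS_sparse n d E \<noteq> SSOS n d E"
proof -
  define x :: "nat \<Rightarrow> expnt" where "x k = Poly_Mapping.single 1 k" for k
  define q :: rpoly where "q = Poly_Mapping.single (x 0) 1 + Poly_Mapping.single (x 1) 2
      + Poly_Mapping.single (x 2) (- 1)"
  have lookup_x: "Poly_Mapping.lookup (x k) m = (if m = 1 then k else 0)" for k m
    by (simp add: x_def lookup_single when_def)
  have x_inj: "x k = x l \<longleftrightarrow> k = l" for k l
    by (metis lookup_x)
  have x_add: "x k + x l = x (k + l)" for k l
    unfolding x_def by (rule single_add[symmetric])
  have q: "q \<in> polys n d"
    unfolding q_def x_def using assms by (intro polys_add polys_single single_in_expnts) auto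
  have "q\<^sup>2 \<in> SSOS n d E"
    by (intro square_in_SSOS q compliant_one_variable[of _ 1])
      (auto simp: q_def lookup_add lookup_single[of "x _"] when_def lookup_x split: if_splits)
  moreover have "q\<^sup>2 \<notin> SDSOS n d"
  proof
    define \<phi> :: "expnt \<Rightarrow> real" where "\<phi> \<alpha> = (if \<alpha> = x 1 then - 1 else 1)" for \<alpha>
    have "\<phi> (\<beta> + \<beta>) = 1" for \<beta>
    proof -
      have "even (Poly_Mapping.lookup (\<beta> + \<beta>) 1)" "odd (Poly_Mapping.lookup (x 1) 1)"
        by (simp_all add: lookup_add lookup_x)
      then have "\<beta> + \<beta> \<noteq> x 1" by metis
      then show ?thesis by (simp add: \<phi>_def)
    qed
    moreover assume "q\<^sup>2 \<in> SDSOS n d"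
    ultimately have "0 \<le> functional \<phi> (q\<^sup>2)"
      by (intro SDSOS_functional_nonneg) (auto simp: \<phi>_def)
    also have "functional \<phi> (q\<^sup>2) = - 4"
      unfolding q_def power2_eq_square distrib_left distrib_right mult_single functional_add
        functional_single x_add \<phi>_def x_inj
      by simp
    finally show False by simp
  qed
  ultimately show ?thesis
    unfolding SDSOS_sparse_def by blast
qed

text \<open>In the square of \<open>1 + x_i + x_j\<close> the sign pattern keeps the three squares
  and negates the three double products, giving \<open>3 - 6 = -3\<close>.\<close>

lemma SDSOS_sparse_neq_SSOS_if_edge:
  assumes "1 \<le> d" and E: "(i, j) \<in> E" "i \<noteq> j" "sparsity_pattern n E"
  shows "SDSOS_sparse n d E \<noteq> SSOS n d E"
proof -
  have ij: "i \<in> {1..n}" "j \<in> {1..n}" "(j, i) \<in> E"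
    using E by (auto simp: sparsity_pattern_def sym_def)
  define q :: rpoly where "q = Poly_Mapping.single 0 1 + Poly_Mapping.single (var i) 1
      + Poly_Mapping.single (var j) 1"
  have lookup_var: "Poly_Mapping.lookup (var k) m = (if m = k then 1 else 0)" for k m
    by (simp add: lookup_single when_def)
  have q: "q \<in> polys n d"
    unfolding q_def using assms ij by (intro polys_add polys_single single_in_expnts zero_in_expnts) auto
  have "q\<^sup>2 \<in> SSOS n d E"
  proof (intro square_in_SSOS q compliant_edge[OF E(1) ij(3)])
    have supp: "m = i \<or> m = j" if "Poly_Mapping.lookup q \<beta> \<noteq> 0" "Poly_Mapping.lookup \<beta> m \<noteq> 0" for \<beta> m
    proof -
      have "\<beta> \<in> {0, var i, var j}"
        using that(1) unfolding q_def lookup_add lookup_single when_def by (auto split: if_splits)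
      with that(2) show ?thesis by (auto simp: lookup_single when_def split: if_splits)
    qed
    show "m = i \<or> m = j" if "Poly_Mapping.lookup q \<beta> \<noteq> 0" "Poly_Mapping.lookup q \<gamma> \<noteq> 0"
      "Poly_Mapping.lookup (\<beta> + \<gamma>) m \<noteq> 0" for \<beta> \<gamma> m
      using supp[OF that(1)] supp[OF that(2)] that(3) unfolding lookup_add by (metis add_0)
  qed
  moreover have "q\<^sup>2 \<notin> SDSOS n d"
  proof
    define \<phi> :: "expnt \<Rightarrow> real" where
      "\<phi> \<alpha> = (if odd (Poly_Mapping.lookup \<alpha> i) \<or> odd (Poly_Mapping.lookup \<alpha> j) then - 1 else 1)" for \<alpha>
    assume "q\<^sup>2 \<in> SDSOS n d"
    then have "0 \<le> functional \<phi> (q\<^sup>2)"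
      by (rule SDSOS_functional_nonneg) (auto simp: \<phi>_def lookup_add)
    also have "functional \<phi> (q\<^sup>2) = - 3"
      unfolding q_def power2_eq_square distrib_left distrib_right mult_single functional_add
        functional_single \<phi>_def lookup_add lookup_var
      using E(2) by simp
    finally show False by simp
  qed
  ultimately show ?thesis
    unfolding SDSOS_sparse_def by blast
qed

section \<open>Evaluation at points and the path polynomial\<close>

definition eval_monom :: "nat \<Rightarrow> (nat \<Rightarrow> real) \<Rightarrow> expnt \<Rightarrow> real" where
  "eval_monom n s \<alpha> = (\<Prod>m\<in>{1..n}. s m ^ Poly_Mapping.lookup \<alpha> m)"

lemma eval_monom_add: "eval_monom n s (\<beta> + \<gamma>) = eval_monom n s \<beta> * eval_monom n s \<gamma>"
  by (simp add: eval_monom_def lookup_add power_add prod.distrib)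

lemma eval_monom_zero: "eval_monom n s 0 = 1"
  by (simp add: eval_monom_def)

lemma eval_monom_var:
  assumes "i \<in> {1..n}"
  shows "eval_monom n s (var i) = s i"
proof -
  have "eval_monom n s (var i) = (\<Prod>m\<in>{1..n}. if m = i then s i else 1)"
    unfolding eval_monom_def by (intro prod.cong refl) (auto simp: lookup_single when_def)
  with assms show ?thesis by simp
qed

lemma eval_monom_cong:
  assumes "\<And>m. Poly_Mapping.lookup \<alpha> m \<noteq> 0 \<Longrightarrow> s m = t m"
  shows "eval_monom n s \<alpha> = eval_monom n t \<alpha>"
  unfolding eval_monom_def
proof (intro prod.cong refl)
  fix m
  show "s m ^ Poly_Mapping.lookup \<alpha> m = t m ^ Poly_Mapping.lookup \<alpha> m"
    using assms[of m] by (cases "Poly_Mapping.lookup \<alpha> m = 0") auto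
qed

lemma functional_eval_monom_gram_poly:
  "functional (eval_monom n s) (gram_poly n d Q) = quad_form (expnts n d) Q (eval_monom n s)"
  by (simp add: functional_gram_poly quad_form_def eval_monom_add mult_ac)

text \<open>The leading coefficient \<open>c\<close> of the square of a nonzero \<open>R\<close> is
  positive, and the square stays at or above \<open>c\<close> for large \<open>t\<close>, whereas
  the bound tends to \<open>0\<close>.\<close>

lemma poly_eq_0_if_decays:
  fixes R :: "real poly"
  assumes "\<And>t. (poly R t)\<^sup>2 \<le> 1 / (1 + t\<^sup>2)"
  shows "R = 0"
proof (rule ccontr)
  assume "R \<noteq> 0"
  define c where "c = (lead_coeff R)\<^sup>2"
  have c: "0 < c" "lead_coeff (R\<^sup>2) = c"
    using \<open>R \<noteq> 0\<close> by (auto simp: c_def lead_coeff_power)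
  then obtain t\<^sub>0 where t\<^sub>0: "\<And>t. t\<^sub>0 \<le> t \<Longrightarrow> c \<le> (poly R t)\<^sup>2"
    using poly_pinfty_gt_lc[of "R\<^sup>2"] by (auto simp: poly_power)
  \<comment> \<open>With \<open>t\<close> at least \<open>1\<close> and \<open>1 / c\<close>,
    \<open>c * (1 + t^2)\<close> is at least \<open>c + 1\<close>.\<close>
  define t where "t = max t\<^sub>0 (1 / c + 1)"
  have t1: "1 \<le> t" and tc: "1 / c \<le> t" using c(1) by (auto simp: t_def le_max_iff_disj)
  have "c \<le> (poly R t)\<^sup>2" by (rule t\<^sub>0) (simp add: t_def)
  also have "\<dots> \<le> 1 / (1 + t\<^sup>2)" by (rule assms)
  finally have "c * (1 + t\<^sup>2) \<le> 1"
    by (simp add: field_simps add_pos_nonneg)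
  moreover have "1 \<le> c * t" using tc c(1) by (simp add: field_simps)
  moreover have "c * t \<le> c * t\<^sup>2"
    using t1 c(1) by (intro mult_left_mono) (auto simp: power2_eq_square)
  ultimately show False using c(1) by (simp add: distrib_left)
qed

definition path_square1 :: "nat \<Rightarrow> nat \<Rightarrow> nat \<Rightarrow> rpoly" where
  "path_square1 i j k = Poly_Mapping.single 0 1 + Poly_Mapping.single (var i) 1
     + Poly_Mapping.single (var j + var k) 1"

definition path_square2 :: "nat \<Rightarrow> nat \<Rightarrow> nat \<Rightarrow> rpoly" where
  "path_square2 i j k = Poly_Mapping.single (var i + var j) 1 + Poly_Mapping.single (var k) (- 1)"

definition path_poly :: "nat \<Rightarrow> nat \<Rightarrow> nat \<Rightarrow> rpoly" where
  "path_poly i j k = (path_square1 i j k)\<^sup>2 + (path_square2 i j k)\<^sup>2"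

text \<open>The cross terms \<open>2 x_i (x_j x_k)\<close> and \<open>-2 (x_i x_j) x_k\<close>
  cancel; they were the only ones with both \<open>x_i\<close> and \<open>x_k\<close>.\<close>

lemma path_poly_expand:
  "path_poly i j k = Poly_Mapping.single 0 1 + Poly_Mapping.single (var i + var i) 1
     + Poly_Mapping.single ((var j + var k) + (var j + var k)) 1
     + Poly_Mapping.single (var i) 2 + Poly_Mapping.single (var j + var k) 2
     + Poly_Mapping.single ((var i + var j) + (var i + var j)) 1
     + Poly_Mapping.single (var k + var k) 1"
proof -
  define X Z U W :: rpoly where defs: "X = Poly_Mapping.single (var i) 1"
    "Z = Poly_Mapping.single (var k) 1" "U = Poly_Mapping.single (var i + var j) 1"
    "W = Poly_Mapping.single (var j + var k) 1"
  have "X * W = U * Z" by (simp add: defs mult_single add_ac)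
  moreover have "(1 + X + W)\<^sup>2 + (U - Z)\<^sup>2
      = 1 + X * X + W * W + (X + X) + (W + W) + U * U + Z * Z + 2 * (X * W - U * Z)"
    by (simp add: power2_eq_square algebra_simps)
  moreover have "path_poly i j k = (1 + X + W)\<^sup>2 + (U - Z)\<^sup>2"
    by (simp add: path_poly_def path_square1_def path_square2_def defs single_uminus)
  moreover have "Poly_Mapping.single (var i) 2 = X + X" "Poly_Mapping.single (var j + var k) 2 = W + W"
    by (simp_all add: defs single_add[symmetric])
  ultimately show ?thesis
    by (simp add: defs mult_single)
qed

text \<open>After the cancellation each monomial lives on one of the edges \<open>i - j\<close> and
  \<open>j - k\<close>.\<close>

lemma path_poly_in_SOS_sparse:
  assumes "2 \<le> d" "i \<in> {1..n}" "j \<in> {1..n}" "k \<in> {1..n}"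
    and E: "(i, j) \<in> E" "(j, i) \<in> E" "(j, k) \<in> E" "(k, j) \<in> E"
  shows "path_poly i j k \<in> SOS_sparse n d E"
proof -
  have pair: "var a + var b \<in> expnts n d" if "a \<in> {1..n}" "b \<in> {1..n}" for a b
  proof -
    have "var a + var b \<in> expnts n (1 + (d - 1))"
      using assms that by (intro expnts_add single_in_expnts) auto
    then show ?thesis using assms by simp
  qed
  have q: "path_square1 i j k \<in> polys n d" "path_square2 i j k \<in> polys n d"
    unfolding path_square1_def path_square2_def using assms
    by (intro polys_add polys_single zero_in_expnts pair single_in_expnts; simp)+
  have mem: "path_poly i j k \<in> polys n (2 * d)"
    unfolding path_poly_def by (intro polys_add square_in_polys q)
  have "path_poly i j k = (\<Sum>q\<leftarrow>[path_square1 i j k, path_square2 i j k]. q\<^sup>2)"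
    by (simp add: path_poly_def)
  with q mem have "path_poly i j k \<in> SOS n d"
    unfolding SOS_def by (auto intro!: exI[of _ "[path_square1 i j k, path_square2 i j k]"])
  moreover have "compliant n E \<alpha>" if "Poly_Mapping.lookup (path_poly i j k) \<alpha> \<noteq> 0" for \<alpha>
  proof -
    from that have "\<alpha> \<in> {0, var i + var i, var i, (var i + var j) + (var i + var j)}
        \<or> \<alpha> \<in> {(var j + var k) + (var j + var k), var j + var k, var k + var k}"
      unfolding path_poly_expand lookup_add lookup_single when_def by (auto split: if_splits)
    then have "(\<forall>m. Poly_Mapping.lookup \<alpha> m \<noteq> 0 \<longrightarrow> m = i \<or> m = j)
        \<or> (\<forall>m. Poly_Mapping.lookup \<alpha> m \<noteq> 0 \<longrightarrow> m = j \<or> m = k)"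
      by (auto simp: lookup_add lookup_single when_def split: if_splits)
    then show ?thesis using compliant_edge E by metis
  qed
  ultimately show ?thesis
    using mem by (simp add: SOS_sparse_def sparse_polys_iff)
qed

text \<open>
  Write \<open>x, y, z\<close> for \<open>x\<^sub>i, x\<^sub>j, x\<^sub>k\<close>.  The polynomial vanishes on the curve \<open>y = t\<close>,
  \<open>x = - 1 / (1 + t\<^sup>2)\<close>, \<open>z = - t / (1 + t\<^sup>2)\<close>, so a positive semidefinite Gram matrix \<open>Q\<close>
  annihilates the monomial vectors of its points.  Let \<open>a t\<close> be the part of such a vector
  with \<open>x\<close> but without \<open>z\<close>, and \<open>b t\<close> the part with \<open>y\<close> only.  If \<open>Q\<close> vanishes on pairs that
  involve both \<open>x\<close> and \<open>z\<close>, then \<open>\<langle>a s, a t\<rangle> = - \<langle>a s, b t\<rangle>\<close> is a polynomial in \<open>t\<close>, while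
  \<open>\<langle>a t, a t\<rangle> = 1 / (1 + t\<^sup>2)\<close>.  By Cauchy-Schwarz the polynomial \<open>\<langle>a 0, a t\<rangle>\<close> tends to \<open>0\<close>
  at infinity, so it is \<open>0\<close>, although its value at \<open>t = 0\<close> is \<open>1\<close>.
\<close>

lemma path_poly_notin_SSOS:
  assumes ijk: "i \<in> {1..n}" "j \<in> {1..n}" "k \<in> {1..n}" "i \<noteq> j" "j \<noteq> k" "i \<noteq> k"
    and "(i, k) \<notin> E"
  shows "path_poly i j k \<notin> SSOS n d E"
proof
  assume "path_poly i j k \<in> SSOS n d E"
  then obtain Q where gram: "path_poly i j k = gram_poly n d Q"
    and psd: "pos_semidef (expnts n d) Q"
    and sparse: "\<And>\<beta> \<gamma>. \<beta> \<in> expnts n d \<Longrightarrow> \<gamma> \<in> expnts n d \<Longrightarrow> \<not> compliant n E (\<beta> + \<gamma>) \<Longrightarrow> Q \<beta> \<gamma> = 0"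
    by (auto simp: SSOS_iff gram_matrix_iff)
  have sym: "symmetric_on (expnts n d) Q" using psd by (simp add: pos_semidef_def)
  let ?B = "bilin (expnts n d) Q"
  define V where "V x y z = eval_monom n
    (\<lambda>m. if m = i then x else if m = j then y else if m = k then z else 0)" for x y z
  have BV: "?B (V x y z) (V x y z) = (1 + x + y * z)\<^sup>2 + (x * y - z)\<^sup>2" for x y z
  proof -
    have var: "V x y z (var i) = x" "V x y z (var j) = y" "V x y z (var k) = z"
      using ijk by (auto simp: V_def eval_monom_var)
    have "?B (V x y z) (V x y z) = functional (V x y z) (path_poly i j k)"
      unfolding gram V_def functional_eval_monom_gram_poly quad_form_bilin ..
    also have "\<dots> = (1 + x + y * z)\<^sup>2 + (x * y - z)\<^sup>2"
      unfolding path_poly_expand functional_add functional_single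
      by (simp add: V_def eval_monom_add eval_monom_zero var[unfolded V_def]
          power2_eq_square algebra_simps)
    finally show ?thesis .
  qed
  define X where "X t = - 1 / (1 + t\<^sup>2)" for t :: real
  define Z where "Z t = - t / (1 + t\<^sup>2)" for t :: real
  \<comment> \<open>Setting a coordinate to \<open>0\<close> deletes the monomials that contain it,
    so \<open>c t\<close> is the part with \<open>z\<close> and the whole vector is
    \<open>a t + b t + c t\<close>.\<close>
  define a where "a t \<beta> = V (X t) t 0 \<beta> - V 0 t 0 \<beta>" for t \<beta>
  define b where "b t = V 0 t 0" for t
  define c where "c t \<beta> = V (X t) t (Z t) \<beta> - V (X t) t 0 \<beta>" for t \<beta>
  have den: "1 + t\<^sup>2 \<noteq> 0" for t :: real
    using zero_le_power2[of t] by linarith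
  have ac: "?B (a s) (c t) = 0" for s t
  proof -
    have "a s \<beta> * Q \<beta> \<gamma> * c t \<gamma> = 0" if "\<beta> \<in> expnts n d" "\<gamma> \<in> expnts n d" for \<beta> \<gamma>
    proof (cases "Poly_Mapping.lookup \<beta> i = 0 \<or> Poly_Mapping.lookup \<gamma> k = 0")
      case True
      then have "a s \<beta> = 0 \<or> c t \<gamma> = 0"
        unfolding a_def c_def V_def right_minus_eq
        by (elim disj_forward) (intro eval_monom_cong; force)+
      then show ?thesis by auto
    next
      case False
      then have "\<not> compliant n E (\<beta> + \<gamma>)"
        using ijk \<open>(i, k) \<notin> E\<close> unfolding compliant_def lookup_add by (metis add_is_0)
      then show ?thesis using sparse that by simp
    qed
    then show ?thesis unfolding bilin_def by (intro sum.neutral ballI)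
  qed
  have orth: "?B (a s) (a t) = - ?B (a s) (b t)" for s t
  proof -
    have "?B (V (X t) t (Z t)) (V (X t) t (Z t)) = 0"
      unfolding BV using den[of t] by (simp add: X_def Z_def field_simps power2_eq_square)
    then have "?B (a s) (V (X t) t (Z t)) = 0"
      using bilin_eq_0_if_isotropic[OF psd] by (simp add: quad_form_bilin)
    moreover have "V (X t) t (Z t) = (\<lambda>\<beta>. (a t \<beta> + b t \<beta>) + c t \<beta>)"
      by (simp add: a_def b_def c_def)
    ultimately show ?thesis using ac[of s t] by (simp add: bilin_add_right)
  qed
  \<comment> \<open>At \<open>z = 0\<close> the polynomial equals \<open>1 - 1 / (1 + t^2)\<close>
    on the one hand and, by \<open>orth\<close>, \<open>1\<close> minus the norm of
    \<open>a t\<close> on the other.\<close>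
  have norm: "?B (a t) (a t) = 1 / (1 + t\<^sup>2)" for t
  proof -
    have "V (X t) t 0 = (\<lambda>\<beta>. a t \<beta> + b t \<beta>)" by (simp add: a_def b_def)
    then have "?B (V (X t) t 0) (V (X t) t 0) = ?B (a t) (a t) + 2 * ?B (a t) (b t) + ?B (b t) (b t)"
      using bilin_commute[OF sym, of "b t" "a t"] by (simp add: bilin_add_left bilin_add_right)
    moreover have "?B (b t) (b t) = 1" unfolding b_def BV by simp
    moreover have "?B (V (X t) t 0) (V (X t) t 0) = 1 - 1 / (1 + t\<^sup>2)"
    proof -
      define r where "r = 1 / (1 + t\<^sup>2)"
      have "(1 - r)\<^sup>2 + (r * t)\<^sup>2 = 1 - 2 * r + r * (r + r * t\<^sup>2)"
        by (simp add: power2_eq_square algebra_simps)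
      moreover have "r + r * t\<^sup>2 = 1" using den[of t] by (simp add: r_def field_simps)
      ultimately show ?thesis unfolding BV X_def minus_divide_left[symmetric] r_def[symmetric]
        by (simp add: r_def[symmetric])
    qed
    ultimately show ?thesis using orth[of t t] by linarith
  qed
  define R where "R = (\<Sum>\<beta>\<in>expnts n d. \<Sum>\<gamma>\<in>expnts n d.
      monom (a 0 \<beta> * Q \<beta> \<gamma> * b 1 \<gamma>) (Poly_Mapping.lookup \<gamma> j))"
  \<comment> \<open>As \<open>0 ^ 0 = 1\<close>, \<open>b 1\<close> is the indicator of the
    monomials in \<open>x_j\<close> alone.\<close>
  have b_power: "b t \<gamma> = b 1 \<gamma> * t ^ Poly_Mapping.lookup \<gamma> j" for t \<gamma>
  proof -
    have "b t \<gamma> = (\<Prod>m\<in>{1..n}. (if m = j then 1 else 0) ^ Poly_Mapping.lookup \<gamma> m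
        * (if m = j then t ^ Poly_Mapping.lookup \<gamma> j else 1))"
      unfolding b_def V_def eval_monom_def using ijk by (intro prod.cong refl) auto
    moreover have "b 1 \<gamma> = (\<Prod>m\<in>{1..n}. (if m = j then 1 else 0) ^ Poly_Mapping.lookup \<gamma> m)"
      unfolding b_def V_def eval_monom_def using ijk by (intro prod.cong refl) auto
    ultimately show ?thesis using ijk by (simp add: prod.distrib)
  qed
  have R: "poly R t = ?B (a 0) (b t)" for t
    unfolding R_def bilin_def poly_sum poly_monom by (subst b_power[of t]) (simp add: mult_ac)
  have "(poly R t)\<^sup>2 \<le> 1 / (1 + t\<^sup>2)" for t
    using bilin_Cauchy_Schwarz[OF psd, of "a 0" "a t"] by (simp add: orth[of 0 t] R norm)
  then have "R = 0" by (rule poly_eq_0_if_decays)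
  then have "?B (a 0) (a 0) = 0" using R[of 0] orth[of 0 0] by simp
  then show False by (simp add: norm)
qed

text \<open>The guards exclude cases of equality. For \<open>d = 1\<close> without edges, sparse
  Gram matrices have arrow shape, where positive semidefinite implies scaled diagonally dominant.
  Over disjoint cliques a sparse sum of squares splits into one for each clique.\<close>

theorem proposition1:
  fixes n d :: nat and E :: "(nat \<times> nat) set"
  assumes "1 \<le> n" and "1 \<le> d" and "sparsity_pattern n E"
  shows "DSOS_sparse n d E \<subset> SDSOS_sparse n d E
    \<and> SDSOS_sparse n d E \<subseteq> SSOS n d E
    \<and> (\<not> (d = 1 \<and> (\<forall>(i, j)\<in>E. i = j)) \<longrightarrow> SDSOS_sparse n d E \<subset> SSOS n d E)
    \<and> SSOS n d E \<subseteq> SOS_sparse n d E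
    \<and> (\<not> (full_pattern n E \<or> d = 1) \<and> \<not> disjoint_cliques n E
          \<longrightarrow> SSOS n d E \<subset> SOS_sparse n d E)
    \<and> (full_pattern n E \<or> d = 1 \<longrightarrow> SSOS n d E = SOS_sparse n d E)"
proof (intro conjI impI)
  show "DSOS_sparse n d E \<subset> SDSOS_sparse n d E"
    using DSOS_sparse_subset_SDSOS_sparse DSOS_sparse_neq_SDSOS_sparse assms by blast
  show "SDSOS_sparse n d E \<subseteq> SSOS n d E"
    by (rule SDSOS_sparse_subset_SSOS)
  show "SSOS n d E \<subseteq> SOS_sparse n d E"
    by (rule SSOS_subset_SOS_sparse)
  show "SDSOS_sparse n d E \<subset> SSOS n d E" if "\<not> (d = 1 \<and> (\<forall>(i, j)\<in>E. i = j))"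
  proof -
    have "SDSOS_sparse n d E \<noteq> SSOS n d E"
    proof (cases "d = 1")
      case True
      with that obtain i j where "(i, j) \<in> E" "i \<noteq> j" by auto
      then show ?thesis using SDSOS_sparse_neq_SSOS_if_edge assms by blast
    next
      case False
      then show ?thesis using SDSOS_sparse_neq_SSOS_if_quartic assms by simp
    qed
    then show ?thesis using SDSOS_sparse_subset_SSOS by blast
  qed
  show "SSOS n d E \<subset> SOS_sparse n d E"
    if sparse: "\<not> (full_pattern n E \<or> d = 1) \<and> \<not> disjoint_cliques n E"
  proof -
    have d: "2 \<le> d" using sparse assms by auto
    \<comment> \<open>Failure of transitivity is a path without its closing edge. Its vertices are
      distinct: a loop in the path would make \<open>(i, k)\<close> the other step, and
      \<open>i = k\<close> would make it a loop.\<close>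
    obtain i j k where path: "(i, j) \<in> with_loops n E" "(j, k) \<in> with_loops n E"
      and ik: "(i, k) \<notin> with_loops n E"
      using sparse transI[of "with_loops n E"] unfolding disjoint_cliques_def by blast
    have E: "(a, b) \<in> E \<Longrightarrow> a \<in> {1..n} \<and> b \<in> {1..n} \<and> (b, a) \<in> E" for a b
      using assms(3) unfolding sparsity_pattern_def sym_def by blast
    have mem: "i \<in> {1..n}" "j \<in> {1..n}" "k \<in> {1..n}"
      using path E unfolding with_loops_def by blast+
    then have neq: "i \<noteq> j" "j \<noteq> k" "i \<noteq> k" and "(i, k) \<notin> E"
      using path ik unfolding with_loops_def by blast+
    moreover have "(i, j) \<in> E" "(j, k) \<in> E"
      using path neq unfolding with_loops_def by blast+
    moreover from this have "(j, i) \<in> E" "(k, j) \<in> E"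
      using E by simp_all
    ultimately have "path_poly i j k \<in> SOS_sparse n d E" "path_poly i j k \<notin> SSOS n d E"
      using path_poly_in_SOS_sparse[OF d mem, of E] path_poly_notin_SSOS[OF mem, of E d] by simp_all
    then show ?thesis using SSOS_subset_SOS_sparse by blast
  qed
  show "SSOS n d E = SOS_sparse n d E" if "full_pattern n E \<or> d = 1"
    using that SSOS_eq_SOS_sparse_if_full[of n E d] SSOS_eq_SOS_sparse_if_quadratic[of n E] by auto
qed

end
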